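(* For every pair of positive integers $n \ge k$, \[ n^k k^{-k/2 - O\left(k/\log k \right)} \le F(n,k) \le \overline{F}(n,k) \le n^k k^{-k/2 + O\left(k /\log k \right)}, \] where the implied constants in the $O(\cdot)$ terms are absolute (independent of $n$ and $k$).
   Context: A word of length $k$ over $[n]=\{1,\dots,n\}$ is a sequence $w=(w_1,\dots,w_k)$ with $w_i\in[n]$; $[n]^k$ is the set of all such words. A word is repetition-free if each symbol occurs at most once in it; $[n]_{(k)}$ denotes the set of repetition-free words of length $k$ over $[n]$. Two words $w,x$ of length $k$ have a reverse if there are positions $i,j$ with $w_i\ne w_j$, $w_i=x_j$ and $w_j=x_i$. A set of words is reverse-free if no two of its words have a reverse. $\overline{F}(n,k)$ is the maximum size of a reverse-free subset of $[n]^k$, and $F(n,k)$ is the maximum size of a reverse-free subset of $[n]_{(k)}$. *)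

theory Defs
  imports Complex_Main
begin

definition words :: "nat \<Rightarrow> nat \<Rightarrow> nat list set" where
  "words n k = {w. length w = k \<and> set w \<subseteq> {1..n}}"

definition rep_free_words :: "nat \<Rightarrow> nat \<Rightarrow> nat list set" where
  "rep_free_words n k = {w \<in> words n k. distinct w}"

definition have_reverse :: "'a list \<Rightarrow> 'a list \<Rightarrow> bool" where
  "have_reverse w x \<longleftrightarrow> length w = length x \<and>
     (\<exists>i<length w. \<exists>j<length w. w ! i \<noteq> w ! j \<and> w ! i = x ! j \<and> w ! j = x ! i)"

definition reverse_free :: "'a list set \<Rightarrow> bool" where
  "reverse_free S \<longleftrightarrow> (\<forall>w\<in>S. \<forall>x\<in>S. w \<noteq> x \<longrightarrow> \<not> have_reverse w x)"

definition F :: "nat \<Rightarrow> nat \<Rightarrow> nat" where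
  "F n k = Max (card ` {S. S \<subseteq> rep_free_words n k \<and> reverse_free S})"

definition F_bar :: "nat \<Rightarrow> nat \<Rightarrow> nat" where
  "F_bar n k = Max (card ` {S. S \<subseteq> words n k \<and> reverse_free S})"

text \<open>\<^const>\<open>Max\<close> is only meaningful on finite nonempty sets; the following facts
  show that both maxima above are attained upper bounds.\<close>

lemma finite_words: "finite (words n k)"
  unfolding words_def
  using finite_lists_length_eq[of "{1..n}" k] by (simp add: conj_commute)

lemma Max_card_reverse_free:
  fixes W :: "'a list set"
  assumes "finite W"
  defines "M \<equiv> Max (card ` {S. S \<subseteq> W \<and> reverse_free S})"
  shows "\<exists>S. S \<subseteq> W \<and> reverse_free S \<and> card S = M"
    and "S \<subseteq> W \<Longrightarrow> reverse_free S \<Longrightarrow> card S \<le> M"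
proof -
  let ?A = "{S. S \<subseteq> W \<and> reverse_free S}"
  have fin: "finite (card ` ?A)"
    using assms(1) by (auto intro!: finite_imageI finite_subset[of ?A "Pow W"])
  have "{} \<in> ?A" by (simp add: reverse_free_def)
  then have "card ` ?A \<noteq> {}" by blast
  then have "M \<in> card ` ?A" unfolding M_def using fin Max_in by blast
  then show "\<exists>S. S \<subseteq> W \<and> reverse_free S \<and> card S = M" by auto
  show "S \<subseteq> W \<Longrightarrow> reverse_free S \<Longrightarrow> card S \<le> M"
    unfolding M_def using fin by (auto intro: Max_ge)
qed

end

theory Submission
  imports Defs "HOL-Library.FuncSet" "HOL-Library.Z2" "HOL-Algebra.Algebraic_Closure_Type"
    "HOL-Analysis.Convex"
begin

text \<open>
  Since \<open>k powr (k / ln k) = exp k\<close>, the claim is that both maxima are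
  \<open>n ^ k * k powr (- k / 2)\<close> up to a factor exponential in \<open>k\<close>.

  Lower bound: if the sets of letters admitted at the positions pairwise share at most one letter,
  no reverse can occur. The lines of an affine plane over a field with \<open>q\<close> elements are such lists of
  length \<open>q\<close> for \<open>q\<^sup>2\<close> positions and letters. A pigeonhole argument yields \<open>I\<close>, \<open>J\<close> with
  \<open>card I = card J = a > 0\<close> and at least \<open>(c * q) ^ a\<close> bijections from \<open>I\<close> to \<open>J\<close> choosing from the
  lists; the other positions are treated recursively with the other letters. This settles
  \<open>n = k\<close>; for larger \<open>n\<close> every letter is replaced by a block of \<open>n div k\<close> letters.

  Upper bound: let a reverse-free set choose from lists of total size \<open>D\<close>. If positions \<open>i\<close>, \<open>j\<close> share
  the letters \<open>a\<close> and \<open>b\<close>, then fixing \<open>a\<close> at \<open>i\<close> excludes \<open>b\<close> at \<open>j\<close>, or fixing \<open>b\<close> at \<open>i\<close> excludes \<open>a\<close>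
  at \<open>j\<close>. By convexity, for \<open>N\<close> of order \<open>D ^ 3 / (n * k)\<^sup>2\<close> there are \<open>N\<close> pairs \<open>(i, a)\<close> such that
  fixing \<open>a\<close> at \<open>i\<close> lowers \<open>D\<close> by \<open>N\<close>. Either one of them is used by a fraction \<open>1 / (2 * N)\<close> of the
  set, and is fixed, or all of them are deleted from the lists, losing half of the set. After \<open>s\<close>
  rounds \<open>D\<close> is \<open>O(k * n / sqrt s)\<close>; after \<open>k\<close> rounds the product of the list sizes is small
  enough, and the losses multiply to \<open>exp (O(k))\<close> times the required powers of \<open>n / sqrt k\<close>.
\<close>

section \<open>Reverse-free sets of functions\<close>

text \<open>Words become functions on a set of positions, so that a restriction to fewer positions
  is again of this kind. Pairs with \<open>w = x\<close> are harmless: \<open>w i = x j\<close> then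
  says \<open>w i = w j\<close>.\<close>

definition rev_free_on :: "'a set \<Rightarrow> ('a \<Rightarrow> 'b) set \<Rightarrow> bool" where
  "rev_free_on P S \<longleftrightarrow>
     (\<forall>w\<in>S. \<forall>x\<in>S. \<forall>i\<in>P. \<forall>j\<in>P. w i \<noteq> w j \<longrightarrow> \<not> (w i = x j \<and> w j = x i))"

lemma rev_free_on_subset:
  "rev_free_on P S \<Longrightarrow> Q \<subseteq> P \<Longrightarrow> T \<subseteq> S \<Longrightarrow> rev_free_on Q T"
  unfolding rev_free_on_def by blast

lemma rev_free_onD:
  "rev_free_on P S \<Longrightarrow> w \<in> S \<Longrightarrow> x \<in> S \<Longrightarrow> i \<in> P \<Longrightarrow> j \<in> P \<Longrightarrow> w i \<noteq> w j \<Longrightarrow>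
     w i = x j \<Longrightarrow> w j = x i \<Longrightarrow> False"
  unfolding rev_free_on_def by blast

text \<open>Multiply \<open>f i \<le> t * exp (f i / t)\<close> over all \<open>i\<close>. This
  replaces the AM-GM inequality, with a scale \<open>t\<close> that can be chosen independently of
  the mean.\<close>

lemma prod_le_power_exp_sum:
  fixes f :: "'a \<Rightarrow> real"
  assumes "t > 0" and "\<And>i. i \<in> A \<Longrightarrow> f i \<ge> 0"
  shows "(\<Prod>i\<in>A. f i) \<le> t ^ card A * exp ((\<Sum>i\<in>A. f i) / t)"
proof (cases "finite A")
  case True
  have "(\<Prod>i\<in>A. f i) \<le> (\<Prod>i\<in>A. t * exp (f i / t))"
  proof (intro prod_mono conjI)
    fix i assume "i \<in> A"
    have "f i / t \<le> exp (f i / t)"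
      using exp_ge_add_one_self[of "f i / t"] by linarith
    then show "f i \<le> t * exp (f i / t)"
      using assms(1) by (simp add: field_simps)
  qed (use assms in auto)
  also have "\<dots> = t ^ card A * exp ((\<Sum>i\<in>A. f i) / t)"
    using True by (simp add: prod.distrib exp_sum sum_divide_distrib)
  finally show ?thesis .
qed simp

section \<open>An affine plane\<close>

lemma ac_bit_add_self: "x + x = 0" for x :: "bit alg_closure"
proof -
  have "(1 :: bit alg_closure) + 1 = to_ac ((1 :: bit) + 1)"
    by (simp only: to_ac_add to_ac_1)
  also have "\<dots> = 0"
    by simp
  finally have "x * (1 + 1) = 0"
    by simp
  then show ?thesis
    by (simp only: distrib_left mult_1_right)
qed

text \<open>Iterated Frobenius map: in each squaring the cross term occurs twice and
  cancels.\<close>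

lemma ac_bit_power_add: "(x + y) ^ 2 ^ r = x ^ 2 ^ r + y ^ 2 ^ r" for x y :: "bit alg_closure"
proof (induction r)
  case (Suc r)
  have sq: "z ^ 2 ^ Suc r = (z ^ 2 ^ r)\<^sup>2" for z :: "bit alg_closure"
    unfolding power_Suc2 power_mult ..
  have "(x + y) ^ 2 ^ Suc r = (x ^ 2 ^ r + y ^ 2 ^ r)\<^sup>2"
    unfolding sq Suc ..
  also have "\<dots> = (x ^ 2 ^ r)\<^sup>2 + (y ^ 2 ^ r)\<^sup>2 + (x ^ 2 ^ r * y ^ 2 ^ r + x ^ 2 ^ r * y ^ 2 ^ r)"
    by (simp only: power2_sum) (simp only: mult_2 distrib_right)
  also have "\<dots> = x ^ 2 ^ Suc r + y ^ 2 ^ Suc r"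
    unfolding sq ac_bit_add_self by simp
  finally show ?case .
qed simp

text \<open>The polynomial splits into linear factors; a factor occurring twice would make its root
  a root of the derivative as well.\<close>

lemma card_roots_separable:
  fixes p :: "'a :: alg_closed_field poly"
  assumes "p \<noteq> 0" and sep: "\<And>a. poly p a = 0 \<Longrightarrow> poly (pderiv p) a \<noteq> 0"
  shows "card {a. poly p a = 0} = degree p"
proof -
  obtain A where A: "size A = degree p" "p = smult (lead_coeff p) (\<Prod>x\<in>#A. [:-x, 1:])"
    using alg_closed_imp_factorization[OF \<open>p \<noteq> 0\<close>] by blast
  have roots: "{a. poly p a = 0} = set_mset A"
  proof -
    have "poly p a = 0 \<longleftrightarrow> a \<in># A" for a
      using arg_cong[OF A(2), of "\<lambda>p. poly p a"] \<open>p \<noteq> 0\<close>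
      by (auto simp: poly_prod_mset image_iff)
    then show ?thesis by auto
  qed
  have "count A x = 1" if x: "x \<in># A" for x
  proof (rule ccontr)
    assume "count A x \<noteq> 1"
    obtain A' where A': "A = add_mset x A'"
      using multi_member_split[OF x] by blast
    with \<open>count A x \<noteq> 1\<close> have "x \<in># A'"
      by (simp add: not_in_iff)
    then obtain B where B: "A = add_mset x (add_mset x B)"
      using A' multi_member_split by metis
    define q where "q = smult (lead_coeff p) (\<Prod>x\<in>#B. [:-x, 1:])"
    define l where "l = [:-x, 1:]"
    have "p = l * (l * q)"
      using A(2) unfolding B q_def l_def by (simp only: image_mset_add_mset prod_mset.add_mset mult_smult_right)
    moreover have "poly l x = 0"
      by (simp add: l_def)
    ultimately have "poly p x = 0" "poly (pderiv p) x = 0"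
      by (simp_all add: pderiv_mult)
    with sep show False by blast
  qed
  then have "size A = card (set_mset A)"
    by (simp add: size_multiset_overloaded_eq)
  with roots A(1) show ?thesis by simp
qed

lemma finite_subfield_char2:
  fixes r :: nat
  assumes "r \<ge> 1"
  defines "K \<equiv> {x :: bit alg_closure. x ^ 2 ^ r = x}"
  shows "card K = 2 ^ r" "finite K"
    "\<And>x y. x \<in> K \<Longrightarrow> y \<in> K \<Longrightarrow> x + y \<in> K" "\<And>x y. x \<in> K \<Longrightarrow> y \<in> K \<Longrightarrow> x * y \<in> K"
proof -
  \<comment> \<open>\<open>K\<close> is the root set of \<open>X ^ (2 ^ r) + X\<close>, where plus
    and minus agree. In characteristic 2 its derivative is the constant 1, so all roots are
    simple.\<close>
  let ?p = "Polynomial.monom (1 :: bit alg_closure) (2 ^ r) + Polynomial.monom 1 1"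
  have "(1::nat) < 2 ^ r"
    using assms by (intro one_less_power) auto
  then have deg: "degree ?p = 2 ^ r"
    by (simp add: degree_add_eq_left degree_monom_eq)
  then have "?p \<noteq> 0" by auto
  have two: "(2 :: bit alg_closure) = 0"
    using ac_bit_add_self[of 1] by simp
  have "(of_nat (2 ^ r) :: bit alg_closure) = 0"
    using assms by (simp add: two)
  then have "pderiv ?p = [:1:]"
    by (simp only: pderiv_add pderiv_monom) (simp add: monom_0)
  then have "card {a. poly ?p a = 0} = 2 ^ r"
    using card_roots_separable[OF \<open>?p \<noteq> 0\<close>] deg by simp
  moreover have "{a. poly ?p a = 0} = K"
  proof -
    have "x ^ 2 ^ r + x = 0 \<longleftrightarrow> x ^ 2 ^ r = x" for x :: "bit alg_closure"
      using ac_bit_add_self[of x] by (metis add_right_imp_eq)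
    then show ?thesis
      by (simp add: K_def poly_monom)
  qed
  ultimately show "card K = 2 ^ r" by simp
  then show "finite K"
    by (metis card.infinite power_not_zero zero_neq_numeral)
  show "x + y \<in> K" "x * y \<in> K" if "x \<in> K" "y \<in> K" for x y
    using that by (simp_all add: K_def ac_bit_power_add power_mult_distrib)
qed

text \<open>Omitting the vertical lines makes the numbers of points and lines equal.\<close>
lemma affine_plane_lists:
  fixes P :: "'a set" and A :: "'b set"
  assumes q: "q = 2 ^ r" and P: "finite P" "card P = q\<^sup>2" and A: "finite A" "card A = q\<^sup>2"
  obtains L where "\<And>i. i \<in> P \<Longrightarrow> L i \<subseteq> A \<and> card (L i) = q"
    "\<And>x. x \<in> A \<Longrightarrow> card {i \<in> P. x \<in> L i} \<le> q"
    "\<And>i j x y. i \<in> P \<Longrightarrow> j \<in> P \<Longrightarrow> i \<noteq> j \<Longrightarrow> x \<in> L i \<Longrightarrow> x \<in> L j \<Longrightarrow> y \<in> L i \<Longrightarrow> y \<in> L j \<Longrightarrow> x = y"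
proof (cases "r = 0")
  \<comment> \<open>For \<open>r = 0\<close> the equation \<open>x ^ 2 ^ r = x\<close> would hold in
    the whole closure, so \<open>q = 1\<close> is treated by hand.\<close>
  case True
  then obtain a b where "P = {a}" "A = {b}"
    using P A q by (auto simp: card_1_singleton_iff)
  with True q show ?thesis
    by (intro that[of "\<lambda>_. A"]) auto
next
  case False
  define K where "K = {x :: bit alg_closure. x ^ 2 ^ r = x}"
  have K: "card K = q" "finite K" and
    K_add: "\<And>x y. x \<in> K \<Longrightarrow> y \<in> K \<Longrightarrow> x + y \<in> K" and
    K_mult: "\<And>x y. x \<in> K \<Longrightarrow> y \<in> K \<Longrightarrow> x * y \<in> K"
    using finite_subfield_char2[of r] False q by (auto simp: K_def)
  have KK: "finite (K \<times> K)" "card (K \<times> K) = q\<^sup>2"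
    using K by (auto simp: card_cartesian_product power2_eq_square)
  obtain f where f: "bij_betw f P (K \<times> K)"
    using finite_same_card_bij P KK by metis
  obtain g where g: "bij_betw g A (K \<times> K)"
    using finite_same_card_bij A KK by metis
  \<comment> \<open>The letter \<open>z\<close> is the point \<open>g z\<close>; the position
    \<open>i\<close> is the line whose slope and intercept form the pair \<open>f i\<close>.\<close>
  define L where "L i = {z \<in> A. snd (g z) = fst (f i) * fst (g z) + snd (f i)}" for i
  have gK: "fst (g z) \<in> K" "snd (g z) \<in> K" if "z \<in> A" for z
    using bij_betwE[OF g] that by (auto simp: mem_Times_iff)
  have fK: "fst (f i) \<in> K" "snd (f i) \<in> K" if "i \<in> P" for i
    using bij_betwE[OF f] that by (auto simp: mem_Times_iff)
  show ?thesis
  proof (rule that)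
    fix i assume i: "i \<in> P"
    \<comment> \<open>A line that is not vertical has exactly one point over each abscissa.\<close>
    have "bij_betw (fst \<circ> g) (L i) K"
    proof (rule bij_betw_imageI)
      show "inj_on (fst \<circ> g) (L i)"
        using bij_betw_imp_inj_on[OF g] by (auto simp: inj_on_def L_def prod_eq_iff)
      show "(fst \<circ> g) ` L i = K"
      proof
        show "(fst \<circ> g) ` L i \<subseteq> K"
          using gK by (auto simp: L_def)
        show "K \<subseteq> (fst \<circ> g) ` L i"
        proof
          fix x assume "x \<in> K"
          then have "(x, fst (f i) * x + snd (f i)) \<in> g ` A"
            using fK[OF i] K_add K_mult bij_betw_imp_surj_on[OF g] by simp
          then obtain z where z: "z \<in> A" "g z = (x, fst (f i) * x + snd (f i))"
            by (metis imageE)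
          then have "z \<in> L i" by (simp add: L_def)
          with z show "x \<in> (fst \<circ> g) ` L i" by force
        qed
      qed
    qed
    then show "L i \<subseteq> A \<and> card (L i) = q"
      using K bij_betw_same_card by (fastforce simp: L_def)
  next
    fix x assume x: "x \<in> A"
    \<comment> \<open>Through a given point there is at most one line of each slope.\<close>
    have "inj_on (fst \<circ> f) {i \<in> P. x \<in> L i}"
      using bij_betw_imp_inj_on[OF f] by (auto simp: inj_on_def L_def prod_eq_iff)
    moreover have "(fst \<circ> f) ` {i \<in> P. x \<in> L i} \<subseteq> K"
      using fK by auto
    ultimately show "card {i \<in> P. x \<in> L i} \<le> q"
      using K card_inj_on_le by metis
  next
    fix i j x y
    assume ij: "i \<in> P" "j \<in> P" "i \<noteq> j" and xy: "x \<in> L i" "x \<in> L j" "y \<in> L i" "y \<in> L j"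
    from ij have ne: "f i \<noteq> f j"
      using bij_betw_imp_inj_on[OF f] by (auto simp: inj_on_def)
    have eqs: "fst (f i) * fst (g x) + snd (f i) = fst (f j) * fst (g x) + snd (f j)"
      "fst (f i) * fst (g y) + snd (f i) = fst (f j) * fst (g y) + snd (f j)"
      using xy by (auto simp: L_def)
    \<comment> \<open>Subtracting the incidences shows that the slopes or the abscissas agree. Equal
      slopes with a common point would force equal lines.\<close>
    have "(fst (f i) - fst (f j)) * (fst (g x) - fst (g y)) =
        (fst (f i) * fst (g x) + snd (f i)) - (fst (f i) * fst (g y) + snd (f i))
        - ((fst (f j) * fst (g x) + snd (f j)) - (fst (f j) * fst (g y) + snd (f j)))"
      by (simp add: algebra_simps)
    also have "\<dots> = 0"
      unfolding eqs by simp
    finally have "(fst (f i) - fst (f j)) * (fst (g x) - fst (g y)) = 0" .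
    moreover have "fst (f i) = fst (f j) \<Longrightarrow> snd (f i) = snd (f j)"
      using eqs(1) by simp
    ultimately have "fst (g x) = fst (g y)"
      using ne by (auto simp: prod_eq_iff)
    moreover from this have "snd (g x) = snd (g y)"
      using xy by (simp add: L_def)
    ultimately have "g x = g y"
      by (simp add: prod_eq_iff)
    then show "x = y"
      using xy bij_betw_imp_inj_on[OF g] by (auto simp: inj_on_def L_def)
  qed
qed

section \<open>The lower bound\<close>

text \<open>Sort the functions \<open>f\<close> choosing from the lists by their image \<open>J\<close> and by a
  transversal \<open>I\<close> of their fibres. Of the \<open>4 ^ card P\<close> pairs \<open>(I, J)\<close> one is popular; it has
  many partial matchings, because \<open>f\<close> has few choices outside \<open>I\<close>: the average of
  \<open>card (L i \<inter> J)\<close> is at most \<open>q * card J / card P\<close>.\<close>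
lemma many_partial_matchings:
  fixes P :: "'a set" and A :: "'b set"
  assumes P: "finite P" "P \<noteq> {}" and A: "finite A" "card A = card P"
    and L: "\<And>i. i \<in> P \<Longrightarrow> L i \<subseteq> A \<and> card (L i) = q"
    and deg: "\<And>x. x \<in> A \<Longrightarrow> card {i \<in> P. x \<in> L i} \<le> q" and q: "q > 0"
  obtains I J where "I \<subseteq> P" "J \<subseteq> A" "I \<noteq> {}" "card J = card I"
    "(real q / (4 * exp 4)) ^ card I \<le> card {f \<in> PiE I L. inj_on f I \<and> f ` I = J}"
proof -
  define k where "k = card P"
  define E where "E = (\<lambda>(I, J). {f \<in> PiE P L. inj_on f I \<and> f ` I = J \<and> f ` P = J})"
  define Z where "Z = Pow P \<times> Pow A"
  have finL: "finite (L i)" if "i \<in> P" for i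
    using L[OF that] A(1) finite_subset by blast
  have Z: "finite Z" "Z \<noteq> {}" "card Z = 4 ^ k"
    using P A by (auto simp: Z_def card_cartesian_product card_Pow k_def power_mult_distrib[symmetric])
  have "PiE P L \<subseteq> (\<Union>c\<in>Z. E c)"
  proof
    fix f assume f: "f \<in> PiE P L"
    \<comment> \<open>\<open>I\<close> picks one position from each fibre of
      \<open>f\<close>.\<close>
    obtain I where I: "I \<subseteq> P" "inj_on f I" "f ` P = f ` I"
      using subset_image_inj[of "f ` P" f P] by auto
    have "f ` P \<subseteq> A"
      using f L by (fastforce simp: PiE_iff)
    with I f have "f \<in> E (I, f ` I)" "(I, f ` I) \<in> Z"
      by (auto simp: E_def Z_def)
    then show "f \<in> (\<Union>c\<in>Z. E c)" by blast
  qed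
  moreover have finE: "finite (\<Union>c\<in>Z. E c)"
    by (rule finite_subset[of _ "PiE P L"]) (auto simp: E_def intro!: finite_PiE P(1) finL)
  ultimately have "card (PiE P L) \<le> card (\<Union>c\<in>Z. E c)"
    by (rule card_mono[rotated])
  also have "\<dots> \<le> (\<Sum>c\<in>Z. card (E c))"
    by (rule card_UN_le[OF Z(1)])
  finally have sum: "q ^ k \<le> (\<Sum>c\<in>Z. card (E c))"
    using P L by (simp add: card_PiE k_def)
  have "\<exists>c\<in>Z. q ^ k \<le> 4 ^ k * card (E c)"
  proof (rule ccontr)
    assume "\<not> ?thesis"
    then have "(\<Sum>c\<in>Z. 4 ^ k * card (E c)) < (\<Sum>c\<in>Z. q ^ k)"
      using Z by (intro sum_strict_mono) auto
    then have "4 ^ k * (\<Sum>c\<in>Z. card (E c)) < 4 ^ k * q ^ k"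
      using Z(3) by (simp add: sum_distrib_left)
    with sum show False by simp
  qed
  then obtain I J where IJ: "I \<subseteq> P" "J \<subseteq> A" and le: "q ^ k \<le> 4 ^ k * card (E (I, J))"
    by (auto simp: Z_def)
  have "card (E (I, J)) > 0"
    using le q by (intro Nat.gr0I) auto
  then obtain f where "f \<in> E (I, J)"
    by (metis card_gt_0_iff all_not_in_conv)
  then have f: "inj_on f I" "f ` I = J" "f ` P = J"
    by (auto simp: E_def)
  have cJ: "card J = card I"
    using f card_image by blast
  have I: "I \<noteq> {}"
    using f P by auto
  have fI: "finite I" "finite J"
    using finite_subset[OF IJ(1) P(1)] finite_subset[OF IJ(2) A(1)] by auto
  define a where "a = card I"
  have ak: "a \<le> k"
    unfolding a_def k_def by (rule card_mono[OF P(1) IJ(1)])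
  define M where "M = {f \<in> PiE I L. inj_on f I \<and> f ` I = J}"
  have finM: "finite M"
    unfolding M_def using IJ(1) finL fI by (intro finite_subset[OF _ finite_PiE[of I L]]) auto
  \<comment> \<open>A function counted in \<open>E (I, J)\<close> is determined by a matching on
    \<open>I\<close> and by its values elsewhere, which lie in \<open>J\<close>.\<close>
  define R where "R = PiE (P - I) (\<lambda>i. L i \<inter> J)"
  have finR: "finite R"
    unfolding R_def using P fI by (intro finite_PiE) auto
  have "card (E (I, J)) \<le> card (M \<times> R)"
  proof (rule card_inj_on_le)
    show "inj_on (\<lambda>f. (restrict f I, restrict f (P - I))) (E (I, J))"
    proof (rule inj_onI)
      fix f g assume fg: "f \<in> E (I, J)" "g \<in> E (I, J)"
        and eq: "(restrict f I, restrict f (P - I)) = (restrict g I, restrict g (P - I))"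
      have "f i = g i" if "i \<in> P" for i
        using eq that by (cases "i \<in> I") (metis Pair_inject restrict_apply DiffI)+
      with fg show "f = g"
        by (intro PiE_ext[of _ P L]) (auto simp: E_def)
    qed
    show "(\<lambda>f. (restrict f I, restrict f (P - I))) ` E (I, J) \<subseteq> M \<times> R"
      using IJ by (auto simp: E_def M_def R_def PiE_iff inj_on_def split: if_splits)
    show "finite (M \<times> R)"
      using finM finR by simp
  qed
  then have cardE: "card (E (I, J)) \<le> card M * card R"
    by (simp add: card_cartesian_product)
  have "real (card R) = (\<Prod>i\<in>P - I. real (card (L i \<inter> J)))"
    using P by (simp add: R_def card_PiE)
  \<comment> \<open>The scale \<open>q / 4\<close> is chosen so that its powers of 4 absorb the
    factor \<open>4 ^ k\<close> of the pigeonhole step, leaving only \<open>4 ^ a\<close>.\<close>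
  also have "\<dots> \<le> (q / 4) ^ card (P - I) * exp ((\<Sum>i\<in>P - I. real (card (L i \<inter> J))) / (q / 4))"
    using q by (intro prod_le_power_exp_sum) auto
  also have "\<dots> \<le> (q / 4) ^ (k - a) * exp (4 * a)"
  proof -
    have "(\<Sum>i\<in>P - I. card (L i \<inter> J)) \<le> (\<Sum>i\<in>P. card (L i \<inter> J))"
      using P by (intro sum_mono2) auto
    \<comment> \<open>Double counting of incidences: each letter of \<open>J\<close> lies in at most
      \<open>q\<close> lists.\<close>
    also have "\<dots> = (\<Sum>i\<in>P. \<Sum>x\<in>J. if x \<in> L i then 1 else 0)"
      using fI by (simp add: sum.If_cases Int_commute)
    also have "\<dots> = (\<Sum>x\<in>J. card {i \<in> P. x \<in> L i})"
      using P by (subst sum.swap) (simp add: sum.If_cases Int_def)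
    also have "\<dots> \<le> (\<Sum>x\<in>J. q)"
      using IJ deg by (intro sum_mono) auto
    finally have "(\<Sum>i\<in>P - I. card (L i \<inter> J)) \<le> a * q"
      by (simp add: cJ a_def)
    then have "(\<Sum>i\<in>P - I. real (card (L i \<inter> J))) \<le> a * q"
      by (metis of_nat_le_iff of_nat_mult of_nat_sum)
    then have "(\<Sum>i\<in>P - I. real (card (L i \<inter> J))) / (q / 4) \<le> 4 * a"
      using q by (simp add: field_simps)
    moreover have "card (P - I) = k - a"
      using fI IJ by (simp add: card_Diff_subset k_def a_def)
    ultimately show ?thesis
      by (intro mult_mono) auto
  qed
  finally have cardR: "real (card R) \<le> (q / 4) ^ (k - a) * exp (4 * a)" .
  have split: "x ^ k = x ^ a * x ^ (k - a)" for x :: real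
    using ak by (simp flip: power_add)
  have "real q ^ k \<le> 4 ^ k * (real (card M) * real (card R))"
    using le cardE by (metis (mono_tags, opaque_lifting) mult_le_mono2 of_nat_le_iff of_nat_mult
        of_nat_numeral of_nat_power order_trans)
  also have "\<dots> \<le> 4 ^ k * (card M * ((q / 4) ^ (k - a) * exp (4 * a)))"
    using cardR by (intro mult_left_mono) auto
  also have "\<dots> = (4 * exp 4) ^ a * card M * q ^ (k - a)"
    by (simp add: split[of 4] power_divide power_mult_distrib exp_of_nat_mult[symmetric] mult.commute)
  finally have "real q ^ a * q ^ (k - a) \<le> (4 * exp 4) ^ a * card M * q ^ (k - a)"
    by (simp add: split[of q])
  then have "real q ^ a \<le> (4 * exp 4) ^ a * card M"
    using q by simp
  then have "(real q / (4 * exp 4)) ^ a \<le> card M"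
    by (simp add: power_divide divide_le_eq mult.commute)
  then show thesis
    using IJ I cJ by (intro that[of I J]) (auto simp: M_def a_def)
qed

text \<open>The plane needs a power of 4 as its number of points, so it is placed on
  \<open>4 ^ r\<close> positions and letters with \<open>4 ^ r \<le> card P < 4 ^ (r + 1)\<close>.
  Then \<open>q = 2 ^ r\<close> is at least half of \<open>sqrt (card P)\<close>, which turns the
  constant 4 into 8. A reverse at \<open>i\<close> and \<open>j\<close> would put two different
  letters into both \<open>L i\<close> and \<open>L j\<close>.\<close>

lemma rev_free_partial_matchings:
  fixes P :: "'a set" and A :: "'b set"
  assumes P: "finite P" "P \<noteq> {}" and A: "finite A" "card A = card P"
  obtains I J M where "I \<subseteq> P" "J \<subseteq> A" "I \<noteq> {}" "card J = card I"
    "M \<subseteq> I \<rightarrow>\<^sub>E J" "\<And>f. f \<in> M \<Longrightarrow> bij_betw f I J" "rev_free_on I M"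
    "(sqrt (card P) / (8 * exp 4)) ^ card I \<le> card M"
proof -
  define k where "k = card P"
  have "k \<ge> 1"
    using P by (simp add: k_def Suc_leI card_gt_0_iff)
  then obtain r where r: "4 ^ r \<le> k" "k < 4 ^ (r + 1)"
    using ex_power_ivl1[of 4 k] by auto
  define q :: nat where "q = 2 ^ r"
  have q2: "q\<^sup>2 = 4 ^ r"
    using power_mult_distrib[of "2::nat" 2 r] by (simp add: q_def power2_eq_square)
  have "q > 0" by (simp add: q_def)
  obtain P' where P': "P' \<subseteq> P" "card P' = q\<^sup>2"
    using obtain_subset_with_card_n[of "q\<^sup>2" P] r q2 by (metis k_def)
  obtain A' where A': "A' \<subseteq> A" "card A' = q\<^sup>2"
    using obtain_subset_with_card_n[of "q\<^sup>2" A] r q2 A by (metis k_def)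
  have fin: "finite P'" "finite A'" and "P' \<noteq> {}"
    using P' A' \<open>q > 0\<close> finite_subset[OF P'(1) P(1)] finite_subset[OF A'(1) A(1)] by auto
  obtain L where L: "\<And>i. i \<in> P' \<Longrightarrow> L i \<subseteq> A' \<and> card (L i) = q"
    "\<And>x. x \<in> A' \<Longrightarrow> card {i \<in> P'. x \<in> L i} \<le> q"
    and line: "\<And>i j x y. i \<in> P' \<Longrightarrow> j \<in> P' \<Longrightarrow> i \<noteq> j \<Longrightarrow> x \<in> L i \<Longrightarrow> x \<in> L j \<Longrightarrow> y \<in> L i \<Longrightarrow> y \<in> L j \<Longrightarrow> x = y"
    by (rule affine_plane_lists[OF q_def fin(1) P'(2) fin(2) A'(2)]) blast
  have cA': "card A' = card P'"
    using A' P' by simp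
  obtain I J where IJ: "I \<subseteq> P'" "J \<subseteq> A'" "I \<noteq> {}" "card J = card I"
    and N: "(real q / (4 * exp 4)) ^ card I \<le> card {f \<in> PiE I L. inj_on f I \<and> f ` I = J}"
    by (rule many_partial_matchings[OF fin(1) \<open>P' \<noteq> {}\<close> fin(2) cA' L \<open>q > 0\<close>])
  define M where "M = {f \<in> PiE I L. inj_on f I \<and> f ` I = J}"
  have "rev_free_on I M"
    unfolding rev_free_on_def
  proof (intro ballI impI notI)
    fix w x i j assume "w \<in> M" "x \<in> M" "i \<in> I" "j \<in> I" "w i \<noteq> w j" "w i = x j \<and> w j = x i"
    then show False
      using line[of i j "w i" "w j"] IJ(1) by (auto simp: M_def PiE_iff) (metis subsetD)+
  qed
  moreover have "sqrt k / (8 * exp 4) \<le> real q / (4 * exp 4)"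
  proof -
    have "k \<le> (2 * q)\<^sup>2"
      using r q2 by (simp add: power_mult_distrib)
    then have "sqrt k \<le> 2 * q"
      by (intro real_le_lsqrt) (auto simp flip: of_nat_power of_nat_mult)
    then show ?thesis
      by (simp add: field_simps)
  qed
  then have "(sqrt k / (8 * exp 4)) ^ card I \<le> (real q / (4 * exp 4)) ^ card I"
    by (intro power_mono) auto
  with N have "(sqrt k / (8 * exp 4)) ^ card I \<le> card M"
    by (simp add: M_def)
  moreover have "M \<subseteq> I \<rightarrow>\<^sub>E J" "\<And>f. f \<in> M \<Longrightarrow> bij_betw f I J"
    by (auto simp: M_def PiE_def bij_betw_def)
  ultimately show thesis
    using IJ P' A' by (intro that[of I J M]) (auto simp: k_def)
qed

text \<open>With \<open>t = k - a\<close> the square of the claim follows from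
  \<open>(1 + a / t) ^ t \<le> exp a \<le> 4 ^ a\<close>. This is the loss from recursing on only
  \<open>k - a\<close> positions.\<close>

lemma sqrt_power_diff_le:
  assumes "a \<le> k"
  shows "sqrt k ^ (k - a) \<le> 2 ^ a * sqrt (real (k - a)) ^ (k - a)"
proof (cases "k = a")
  case False
  define t where "t = k - a"
  have t: "t > 0" "real k = t + a"
    using assms False by (auto simp: t_def)
  have "1 + a / t \<le> exp (a / t)"
    by (rule exp_ge_add_one_self)
  then have "(1 + a / t) ^ t \<le> exp (a / t) ^ t"
    by (intro power_mono) auto
  also have "\<dots> = exp 1 ^ a"
    using t by (simp flip: exp_of_nat_mult)
  also have "\<dots> \<le> 4 ^ a"
    using exp_le by (intro power_mono) auto
  finally have "(1 + a / t) ^ t * real t ^ t \<le> 4 ^ a * real t ^ t"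
    by (intro mult_right_mono) auto
  moreover have "(1 + a / t) ^ t * real t ^ t = real k ^ t"
    using t by (simp add: field_simps flip: power_mult_distrib)
  ultimately have "sqrt (real k ^ t) \<le> sqrt (4 ^ a * real t ^ t)"
    by simp
  then show ?thesis
    by (simp add: real_sqrt_power real_sqrt_mult t_def)
qed (simp add: assms)

text \<open>Strong induction: matchings between \<open>I\<close> and \<open>J\<close> are combined
  freely with bijections of the remaining positions and letters. No reverse involves both parts,
  since their letters come from the disjoint sets \<open>J\<close> and \<open>A - J\<close>.\<close>

lemma rev_free_bijections:
  fixes P :: "'a set" and A :: "'b set"
  assumes "finite P" "finite A" "card P = k" "card A = k"
  shows "\<exists>S. S \<subseteq> P \<rightarrow>\<^sub>E A \<and> (\<forall>f\<in>S. bij_betw f P A) \<and> rev_free_on P S \<and>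
    (sqrt k / (16 * exp 4)) ^ k \<le> card S"
  using assms
proof (induction k arbitrary: P A rule: less_induct)
  case (less k)
  note P = less.prems(1,3) and A = less.prems(2,4)
  show ?case
  proof (cases "k = 0")
    case True
    with P A have "P = {}" "A = {}" by auto
    with True show ?thesis
      by (intro exI[of _ "{\<lambda>_. undefined}"]) (auto simp: rev_free_on_def bij_betw_def)
  next
    case False
    with P have "P \<noteq> {}" by auto
    obtain I J M where IJ: "I \<subseteq> P" "J \<subseteq> A" "I \<noteq> {}" "card J = card I"
      and M: "M \<subseteq> I \<rightarrow>\<^sub>E J" "\<And>f. f \<in> M \<Longrightarrow> bij_betw f I J" "rev_free_on I M"
      and cM: "(sqrt k / (8 * exp 4)) ^ card I \<le> card M"
      using rev_free_partial_matchings[OF P(1) \<open>P \<noteq> {}\<close> A(1)] P A by metis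
    define a where "a = card I"
    have fin: "finite I" "finite J"
      using finite_subset[OF IJ(1) P(1)] finite_subset[OF IJ(2) A(1)] by auto
    have a: "0 < a" "a \<le> k"
      using IJ(3) fin card_mono[OF P(1) IJ(1)] P by (auto simp: a_def card_gt_0_iff)
    have "card (P - I) = k - a" "card (A - J) = k - a" "k - a < k"
      using IJ fin P A a by (auto simp: card_Diff_subset a_def)
    then obtain T where T: "T \<subseteq> (P - I) \<rightarrow>\<^sub>E (A - J)" "\<And>f. f \<in> T \<Longrightarrow> bij_betw f (P - I) (A - J)"
      "rev_free_on (P - I) T" and cT: "(sqrt (real (k - a)) / (16 * exp 4)) ^ (k - a) \<le> card T"
      using less.IH[of "k - a" "P - I" "A - J"] P A by auto
    define h where "h = (\<lambda>(f, g). \<lambda>i\<in>P. if i \<in> I then f i else g i :: 'b)"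
    define S where "S = h ` (M \<times> T)"
    have h_I: "h (f, g) i = f i" if "i \<in> I" for f g i
      using that IJ by (auto simp: h_def)
    have h_P: "h (f, g) i = g i" if "i \<in> P - I" for f g i
      using that by (auto simp: h_def)
    have "inj_on h (M \<times> T)"
    proof (rule inj_onI, clarify)
      fix f g f' g' assume *: "f \<in> M" "f' \<in> M" "g \<in> T" "g' \<in> T" and eq: "h (f, g) = h (f', g')"
      have "f = f'"
        by (rule PiE_ext[of _ I "\<lambda>_. J"]) (use * M eq h_I in \<open>auto, metis\<close>)
      moreover have "g = g'"
        by (rule PiE_ext[of _ "P - I" "\<lambda>_. A - J"]) (use * T eq h_P in \<open>auto, metis Diff_iff\<close>)
      ultimately show "f = f' \<and> g = g'" ..
    qed
    then have cS: "card S = card M * card T"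
      by (simp add: S_def card_image card_cartesian_product)
    have bij: "bij_betw (h (f, g)) P A" if "f \<in> M" "g \<in> T" for f g
    proof -
      have "bij_betw (h (f, g)) I J" "bij_betw (h (f, g)) (P - I) (A - J)"
        using M(2)[OF that(1)] T(2)[OF that(2)] bij_betw_cong[of I "h (f, g)" f J, OF h_I]
          bij_betw_cong[of "P - I" "h (f, g)" g "A - J", OF h_P] by simp_all
      then have "bij_betw (h (f, g)) (I \<union> (P - I)) (J \<union> (A - J))"
        by (rule bij_betw_combine) auto
      then show ?thesis
        using IJ by (simp add: Un_absorb1)
    qed
    have rf: "rev_free_on P S"
      unfolding rev_free_on_def
    proof (intro ballI impI notI)
      fix w x i j
      assume wx: "w \<in> S" "x \<in> S" and ij: "i \<in> P" "j \<in> P" and ne: "w i \<noteq> w j"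
        and rev: "w i = x j \<and> w j = x i"
      obtain f g f' g' where fg: "f \<in> M" "g \<in> T" "f' \<in> M" "g' \<in> T" "w = h (f, g)" "x = h (f', g')"
        using wx by (auto simp: S_def)
      have mem: "f i \<in> J" "f' i \<in> J" if "i \<in> I" for i
        using fg M(1) that by (auto simp: PiE_iff)
      have mem': "g i \<notin> J" "g' i \<notin> J" if "i \<in> P - I" for i
        using fg T(1) that by (auto simp: PiE_iff)
      consider "i \<in> I" "j \<in> I" | "i \<in> P - I" "j \<in> P - I" | "i \<in> I" "j \<in> P - I" | "j \<in> I" "i \<in> P - I"
        using ij by blast
      then show False
      proof cases
        case 1
        then show False
          using rev_free_onD[OF M(3) fg(1,3) 1] ne rev fg h_I by auto
      next
        case 2
        then show False
          using rev_free_onD[OF T(3) fg(2,4) 2] ne rev fg h_P by auto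
      next
        case 3
        then show False
          using mem(1)[of i] mem'(2)[of j] rev fg h_I h_P by auto
      next
        case 4
        then show False
          using mem(1)[of j] mem'(2)[of i] rev fg h_I h_P by auto
      qed
    qed
    have "(sqrt k / (16 * exp 4)) ^ k = (sqrt k / (16 * exp 4)) ^ a * (sqrt k / (16 * exp 4)) ^ (k - a)"
      using a by (simp flip: power_add)
    \<comment> \<open>One factor 2 per position of \<open>I\<close> is split off the constant 16; it
      pays for the \<open>2 ^ a\<close> of \<open>sqrt_power_diff_le\<close>.\<close>
    also have "\<dots> = (sqrt k / (8 * exp 4) / 2) ^ a * (sqrt k / (16 * exp 4)) ^ (k - a)"
      by simp
    also have "\<dots> = (sqrt k / (8 * exp 4)) ^ a / 2 ^ a * (sqrt k ^ (k - a) / (16 * exp 4) ^ (k - a))"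
      by (simp only: power_divide)
    also have "\<dots> \<le> (sqrt k / (8 * exp 4)) ^ a / 2 ^ a *
        (2 ^ a * sqrt (real (k - a)) ^ (k - a) / (16 * exp 4) ^ (k - a))"
      using sqrt_power_diff_le[OF a(2)] by (intro mult_left_mono divide_right_mono) auto
    also have "\<dots> = (sqrt k / (8 * exp 4)) ^ a * (sqrt (real (k - a)) / (16 * exp 4)) ^ (k - a)"
      by (simp only: power_divide) simp
    also have "\<dots> \<le> real (card M) * real (card T)"
      using cM cT by (intro mult_mono) (auto simp: a_def)
    finally have "(sqrt k / (16 * exp 4)) ^ k \<le> card S"
      using cS by simp
    moreover have "\<forall>f\<in>S. bij_betw f P A"
      using bij by (auto simp: S_def)
    moreover have "S \<subseteq> P \<rightarrow>\<^sub>E A"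
    proof
      fix w assume "w \<in> S"
      then have "bij_betw w P A" "w \<in> extensional P"
        using bij by (auto simp: S_def h_def)
      then show "w \<in> P \<rightarrow>\<^sub>E A"
        by (auto simp: PiE_iff bij_betw_def)
    qed
    ultimately show ?thesis
      using rf by blast
  qed
qed

text \<open>Each letter of a bijection becomes a block of \<open>d\<close> letters, from which
  \<open>g\<close> chooses freely. Division by \<open>d\<close> recovers the block, so a reverse of
  two words gives equal block numbers crosswise. Since the functions are injective, the two blocks
  differ, and a reverse in \<open>S\<close> results.\<close>

lemma F_ge:
  assumes "1 \<le> k" "k \<le> n"
  shows "(real n / (32 * exp 4 * sqrt k)) ^ k \<le> F n k"
proof -
  define d where "d = n div k"
  have d: "d \<ge> 1" "d * k \<le> n" "n < 2 * (d * k)"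
  proof -
    show "d \<ge> 1"
      using assms by (simp add: d_def Suc_le_eq div_greater_zero_iff)
    show "d * k \<le> n"
      by (simp add: d_def)
    have "n < d * k + k"
      unfolding d_def using assms by (metis add_less_cancel_left div_mult_mod_eq mod_less_divisor
          less_le_trans zero_less_one)
    also have "\<dots> \<le> 2 * (d * k)"
      using \<open>d \<ge> 1\<close> by simp
    finally show "n < 2 * (d * k)" .
  qed
  obtain S where S: "S \<subseteq> {..<k} \<rightarrow>\<^sub>E {..<k}" "\<And>f. f \<in> S \<Longrightarrow> bij_betw f {..<k} {..<k}"
    "rev_free_on {..<k} S" and cS: "(sqrt k / (16 * exp 4)) ^ k \<le> card S"
    using rev_free_bijections[of "{..<k}" "{..<k}" k] by auto
  define G where "G = {..<k} \<rightarrow>\<^sub>E {..<d}"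
  \<comment> \<open>\<open>Suc\<close> shifts the blocks to the alphabet starting at 1.\<close>
  define h where "h = (\<lambda>(f, g). map (\<lambda>i. Suc (f i * d + g i)) [0..<k])"
  have len: "length (h c) = k" for c
    by (cases c) (simp add: h_def)
  have nth: "h (f, g) ! i = Suc (f i * d + g i)" if "i < k" for f g i
    using that by (simp add: h_def)
  have dm: "(f i * d + g i) div d = f i" "(f i * d + g i) mod d = g i" if "g \<in> G" "i < k" for f g i
  proof -
    have "g i < d"
      using that by (auto simp: G_def PiE_iff)
    then show "(f i * d + g i) div d = f i" "(f i * d + g i) mod d = g i"
      by simp_all
  qed
  have inj: "inj_on h (S \<times> G)"
  proof (rule inj_onI, clarify)
    fix f g f' g' assume *: "f \<in> S" "g \<in> G" "f' \<in> S" "g' \<in> G" and eq: "h (f, g) = h (f', g')"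
    have "f i * d + g i = f' i * d + g' i" if "i < k" for i
      using arg_cong[OF eq, of "\<lambda>w. w ! i"] nth[OF that] by simp
    then have "f i = f' i" "g i = g' i" if "i < k" for i
      using dm[OF *(2) that] dm[OF *(4) that] that by metis+
    then show "f = f' \<and> g = g'"
      using * S(1) by (auto simp: G_def intro!: PiE_ext[of _ "{..<k}"])
  qed
  have "h ` (S \<times> G) \<subseteq> rep_free_words n k"
  proof clarify
    fix f g assume f: "f \<in> S" and g: "g \<in> G"
    have "Suc (f i * d + g i) \<le> n" if "i < k" for i
    proof -
      have "Suc (f i) \<le> k" "Suc (g i) \<le> d"
        using f g S(1) that by (auto simp: G_def PiE_iff Suc_le_eq)
      have "Suc (f i * d + g i) \<le> Suc (f i) * d"
        using \<open>Suc (g i) \<le> d\<close> by simp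
      also have "\<dots> \<le> k * d"
        using \<open>Suc (f i) \<le> k\<close> by (rule mult_le_mono1)
      finally show ?thesis
        using d(2) by (simp add: mult.commute)
    qed
    moreover have "inj_on (\<lambda>i. Suc (f i * d + g i)) {0..<k}"
    proof (rule inj_onI)
      fix i j assume ij: "i \<in> {0..<k}" "j \<in> {0..<k}" and "Suc (f i * d + g i) = Suc (f j * d + g j)"
      then have "f i = f j"
        using dm(1)[OF g, of i f] dm(1)[OF g, of j f] by simp
      then show "i = j"
        using bij_betw_imp_inj_on[OF S(2)[OF f]] ij by (auto simp: inj_on_def)
    qed
    ultimately show "h (f, g) \<in> rep_free_words n k"
      by (auto simp: h_def rep_free_words_def words_def distinct_map)
  qed
  moreover have "reverse_free (h ` (S \<times> G))"
    unfolding reverse_free_def have_reverse_def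
  proof (intro ballI impI notI)
    fix w x assume "w \<in> h ` (S \<times> G)" "x \<in> h ` (S \<times> G)"
    then obtain f g f' g' where fg: "f \<in> S" "g \<in> G" "f' \<in> S" "g' \<in> G"
      and wx: "w = h (f, g)" "x = h (f', g')"
      by auto
    assume "length w = length x \<and>
      (\<exists>i<length w. \<exists>j<length w. w ! i \<noteq> w ! j \<and> w ! i = x ! j \<and> w ! j = x ! i)"
    then obtain i j where ij: "i < k" "j < k"
      and rev: "w ! i \<noteq> w ! j" "w ! i = x ! j" "w ! j = x ! i"
      by (auto simp: wx len)
    have eq: "f i * d + g i = f' j * d + g' j" "f j * d + g j = f' i * d + g' i"
      and ne: "f i * d + g i \<noteq> f j * d + g j"
      using rev nth ij by (auto simp: wx)
    have "f i = f' j" "f j = f' i"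
      using arg_cong[OF eq(1), of "\<lambda>x. x div d"] arg_cong[OF eq(2), of "\<lambda>x. x div d"] fg ij
      by (simp_all add: dm)
    moreover have "f i \<noteq> f j"
      using bij_betw_imp_inj_on[OF S(2)[OF fg(1)]] ij ne by (auto simp: inj_on_def)
    ultimately show False
      using rev_free_onD[OF S(3) fg(1,3), of i j] ij by auto
  qed
  moreover have "finite (rep_free_words n k)"
    by (simp add: rep_free_words_def finite_words)
  ultimately have "card (h ` (S \<times> G)) \<le> F n k"
    unfolding F_def by (intro Max_card_reverse_free(2))
  then have "card S * d ^ k \<le> F n k"
    unfolding card_image[OF inj] by (simp add: card_cartesian_product G_def card_PiE)
  then have F: "real (card S) * real d ^ k \<le> F n k"
    by (metis of_nat_le_iff of_nat_mult of_nat_power)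
  \<comment> \<open>Rounding in \<open>n div k\<close> loses at most a factor 2 per position, hence
    32 instead of 16.\<close>
  have "real n / (32 * exp 4 * sqrt k) \<le> sqrt k / (16 * exp 4) * d"
  proof -
    obtain s where s: "sqrt k = s" "s > 0"
      using assms by simp
    have "real n \<le> 2 * (real d * (sqrt k * sqrt k))"
      using d(3) by (simp flip: of_nat_mult of_nat_le_iff)
    then show ?thesis
      using s(2) unfolding s(1) by (simp add: field_simps)
  qed
  then have "(real n / (32 * exp 4 * sqrt k)) ^ k \<le> (sqrt k / (16 * exp 4) * d) ^ k"
    by (intro power_mono) auto
  also have "\<dots> \<le> card S * real d ^ k"
    unfolding power_mult_distrib using cS by (intro mult_right_mono) auto
  finally show ?thesis
    using F by linarith
qed

section \<open>The upper bound\<close>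

text \<open>These are the lists that remain once the letter \<open>a\<close> is fixed at position
  \<open>i\<close>.\<close>

definition followers :: "('a \<Rightarrow> 'b) set \<Rightarrow> 'a \<Rightarrow> 'b \<Rightarrow> 'a \<Rightarrow> 'b set" where
  "followers S i a j = {w j |w. w \<in> S \<and> w i = a}"

text \<open>For different common letters \<open>a\<close>, \<open>b\<close>, words of
  \<open>S\<close> showing \<open>(a, b)\<close> and \<open>(b, a)\<close> at \<open>(i, j)\<close>
  would have a reverse, so one of these pairs is missing. At least half of the off-diagonal pairs
  are therefore counted on the right.\<close>

lemma sum_card_nonfollowers_ge:
  assumes S: "rev_free_on P S" and ij: "i \<in> P" "j \<in> P" and fin: "finite (L i)" "finite (L j)"
  defines "s \<equiv> real (card (L i \<inter> L j))"
  shows "(s\<^sup>2 - s) / 2 \<le> (\<Sum>a\<in>L i. real (card (L j - followers S i a j)))"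
proof -
  define C where "C = L i \<inter> L j"
  define Z where "Z = (SIGMA a:L i. L j - followers S i a j)"
  have finC: "finite C" and finX: "finite Z"
    using fin by (auto simp: C_def Z_def)
  \<comment> \<open>\<open>Z\<close> consists of the missing pairs; together with its transpose and
    the diagonal it covers the square.\<close>
  have "C \<times> C \<subseteq> Z \<union> prod.swap ` Z \<union> (\<lambda>a. (a, a)) ` C"
  proof clarify
    fix a b assume ab: "a \<in> C" "b \<in> C" "(a, b) \<notin> (\<lambda>a. (a, a)) ` C" "(a, b) \<notin> prod.swap ` Z"
    then have "(b, a) \<notin> Z"
      by (metis image_eqI swap_simp)
    with ab have "a \<in> followers S i b j"
      by (auto simp: Z_def C_def)
    then obtain w where w: "w \<in> S" "w i = b" "w j = a"
      by (auto simp: followers_def)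
    have "b \<notin> followers S i a j"
    proof
      assume "b \<in> followers S i a j"
      then obtain x where "x \<in> S" "x i = a" "x j = b"
        by (auto simp: followers_def)
      with w ab show False
        using rev_free_onD[OF S w(1), of x i j] ij by auto
    qed
    with ab show "(a, b) \<in> Z"
      by (auto simp: Z_def C_def)
  qed
  then have "card (C \<times> C) \<le> card (Z \<union> prod.swap ` Z \<union> (\<lambda>a. (a, a)) ` C)"
    using finC finX by (intro card_mono) auto
  also have "\<dots> \<le> card Z + card (prod.swap ` Z) + card ((\<lambda>a. (a, a)) ` C)"
    by (intro order_trans[OF card_Un_le] add_right_mono card_Un_le)
  also have "\<dots> \<le> 2 * card Z + card C"
    using card_image_le[OF finX, of prod.swap] card_image_le[OF finC, of "\<lambda>a. (a, a)"] by simp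
  finally have "real (card C * card C) \<le> real (2 * card Z + card C)"
    unfolding card_cartesian_product of_nat_le_iff .
  moreover have "card Z = (\<Sum>a\<in>L i. card (L j - followers S i a j))"
    unfolding Z_def using fin by (subst card_SigmaI) auto
  ultimately show ?thesis
    by (simp add: s_def C_def power2_eq_square)
qed

text \<open>Cauchy-Schwarz for the numbers of lists containing each letter: they add up to
  \<open>D\<close>, and their squares count the common letters of pairs of positions.\<close>

lemma sum_card_Int_ge:
  fixes L :: "'a \<Rightarrow> 'b set"
  assumes "finite P" "finite A" and L: "\<And>i. i \<in> P \<Longrightarrow> L i \<subseteq> A"
  defines "D \<equiv> \<Sum>i\<in>P. real (card (L i))"
  shows "D\<^sup>2 \<le> card A * (\<Sum>i\<in>P. \<Sum>j\<in>P. real (card (L i \<inter> L j)))"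
proof -
  define e where "e i x = (if x \<in> L i then 1 else 0 :: real)" for i x
  have "card (L i) = (\<Sum>x\<in>A. e i x)" if "i \<in> P" for i
    using assms(2) L[OF that] by (simp add: e_def sum.If_cases Int_absorb1)
  then have "D = (\<Sum>i\<in>P. \<Sum>x\<in>A. e i x)"
    by (simp add: D_def)
  also have "\<dots> = (\<Sum>x\<in>A. \<Sum>i\<in>P. e i x)"
    by (rule sum.swap)
  finally have "D\<^sup>2 \<le> (\<Sum>x\<in>A. (\<Sum>i\<in>P. e i x)\<^sup>2) * card A"
    using sum_squared_le_sum_of_squares[of "\<lambda>x. \<Sum>i\<in>P. e i x" A] by simp
  also have "(\<Sum>x\<in>A. (\<Sum>i\<in>P. e i x)\<^sup>2) = (\<Sum>x\<in>A. \<Sum>i\<in>P. \<Sum>j\<in>P. e i x * e j x)"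
    by (simp add: power2_eq_square sum_product)
  also have "\<dots> = (\<Sum>i\<in>P. \<Sum>j\<in>P. \<Sum>x\<in>A. e i x * e j x)"
    by (subst sum.swap, rule sum.cong[OF refl], rule sum.swap)
  also have "\<dots> = (\<Sum>i\<in>P. \<Sum>j\<in>P. real (card (L i \<inter> L j)))"
  proof (intro sum.cong refl)
    fix i j assume "i \<in> P" "j \<in> P"
    then have "(\<Sum>x\<in>A. e i x * e j x) = (\<Sum>x\<in>A. if x \<in> L i \<inter> L j then 1 else 0)"
      by (intro sum.cong) (auto simp: e_def)
    also have "\<dots> = card (L i \<inter> L j)"
      using assms(2) L[OF \<open>i \<in> P\<close>] by (subst sum.If_cases) (auto intro!: arg_cong[of _ _ card])
    finally show "(\<Sum>x\<in>A. e i x * e j x) = real (card (L i \<inter> L j))" .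
  qed
  finally show ?thesis
    by (simp add: mult.commute)
qed

text \<open>The decrease of the total list size when \<open>a\<close> is fixed at \<open>i\<close>:
  the list of \<open>i\<close> disappears and the others shrink to the followers.\<close>

definition list_drop :: "'a set \<Rightarrow> ('a \<Rightarrow> 'b set) \<Rightarrow> ('a \<Rightarrow> 'b) set \<Rightarrow> 'a \<Rightarrow> 'b \<Rightarrow> real" where
  "list_drop P L S i a =
     real (card (L i)) + (\<Sum>j\<in>P - {i}. real (card (L j - followers S i a j)))"

text \<open>Convexity is used twice: over the letters for \<open>G\<close>, then over the ordered
  pairs of positions for the sum of squares. The two lower bounds on \<open>D\<close> ensure that
  the diagonal terms, and later the linear terms in \<open>(s i j)\<^sup>2 - s i j\<close>, cost at
  most half.\<close>

lemma sum_list_drop_ge: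
  fixes P :: "'a set" and A :: "'b set" and L :: "'a \<Rightarrow> 'b set"
  assumes P: "finite P" "card P \<le> k" and A: "finite A" "card A = n" "k \<ge> 1" "n \<ge> 1"
    and L: "\<And>i. i \<in> P \<Longrightarrow> L i \<subseteq> A" and S: "rev_free_on P S"
  defines "D \<equiv> \<Sum>i\<in>P. real (card (L i))"
  assumes D: "D \<ge> 2 * n" "D\<^sup>2 \<ge> 4 * n * real k ^ 2"
  shows "D ^ 4 / (16 * n ^ 2 * k ^ 2) \<le> (\<Sum>i\<in>P. \<Sum>a\<in>L i. list_drop P L S i a)"
proof -
  have finL: "finite (L i)" if "i \<in> P" for i
    using L[OF that] A finite_subset by blast
  define s where "s i j = real (card (L i \<inter> L j))" for i j
  define Q where "Q = (SIGMA i:P. P - {i})"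
  define G where "G = (\<Sum>(i, j)\<in>Q. s i j)"
  have finQ: "finite Q"
    using P by (simp add: Q_def)
  have Q_sum: "(\<Sum>(i, j)\<in>Q. g i j) = (\<Sum>i\<in>P. \<Sum>j\<in>P - {i}. g i j)" for g :: "'a \<Rightarrow> 'a \<Rightarrow> real"
    unfolding Q_def using P by (subst sum.Sigma) auto
  have cQ: "real (card Q) \<le> k\<^sup>2"
  proof -
    have "card Q \<le> card (P \<times> P)"
      unfolding Q_def using P by (intro card_mono) auto
    also have "\<dots> \<le> k\<^sup>2"
      using P by (simp add: card_cartesian_product power2_eq_square mult_mono)
    finally show ?thesis
      by (simp flip: of_nat_power)
  qed
  have "D\<^sup>2 / n \<le> (\<Sum>i\<in>P. \<Sum>j\<in>P. s i j)"
    using sum_card_Int_ge[OF P(1) A(1) L] A by (simp add: D_def s_def field_simps)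
  also have "\<dots> = (\<Sum>i\<in>P. s i i + (\<Sum>j\<in>P - {i}. s i j))"
    using P by (intro sum.cong refl) (simp add: sum.remove)
  also have "\<dots> = D + G"
    by (simp add: sum.distrib G_def Q_sum D_def s_def)
  finally have "D\<^sup>2 / n \<le> D + G" .
  moreover have "D * (2 * n) \<le> D * D"
    using D(1) by (intro mult_left_mono) auto
  then have "D \<le> D\<^sup>2 / (2 * n)"
    using A by (simp add: field_simps power2_eq_square)
  ultimately have G: "D\<^sup>2 / (2 * n) \<le> G"
    by (simp add: field_simps)
  have "4 * n * real k ^ 2 / (2 * n) \<le> D\<^sup>2 / (2 * n)"
    using D(2) by (intro divide_right_mono) auto
  then have G2: "2 * real k ^ 2 \<le> G"
    using G A by simp
  have "G\<^sup>2 \<le> (\<Sum>(i, j)\<in>Q. (s i j)\<^sup>2) * card Q"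
    using sum_squared_le_sum_of_squares[of "\<lambda>(i, j). s i j" Q] by (simp add: G_def case_prod_unfold)
  also have "\<dots> \<le> (\<Sum>(i, j)\<in>Q. (s i j)\<^sup>2) * k\<^sup>2"
    using cQ by (intro mult_left_mono sum_nonneg) auto
  finally have "G\<^sup>2 / k\<^sup>2 \<le> (\<Sum>(i, j)\<in>Q. (s i j)\<^sup>2)"
    using A by (simp add: field_simps)
  moreover have "0 \<le> G"
    by (rule order_trans[OF _ G2]) simp
  then have "G \<le> G\<^sup>2 / (2 * real k ^ 2)"
    using mult_left_mono[OF G2, of G] A by (simp add: field_simps power2_eq_square)
  ultimately have "G\<^sup>2 / (4 * real k ^ 2) \<le> ((\<Sum>(i, j)\<in>Q. (s i j)\<^sup>2) - G) / 2"
    by (simp add: field_simps)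
  also have "\<dots> = (\<Sum>i\<in>P. \<Sum>j\<in>P - {i}. ((s i j)\<^sup>2 - s i j) / 2)"
    by (simp add: G_def Q_sum sum_subtractf sum_divide_distrib[symmetric])
  also have "\<dots> \<le> (\<Sum>i\<in>P. \<Sum>j\<in>P - {i}. \<Sum>a\<in>L i. real (card (L j - followers S i a j)))"
    unfolding s_def using S finL by (intro sum_mono sum_card_nonfollowers_ge) auto
  also have "\<dots> = (\<Sum>i\<in>P. \<Sum>a\<in>L i. \<Sum>j\<in>P - {i}. real (card (L j - followers S i a j)))"
    by (intro sum.cong refl sum.swap)
  also have "\<dots> \<le> (\<Sum>i\<in>P. \<Sum>a\<in>L i. list_drop P L S i a)"
    by (intro sum_mono) (simp add: list_drop_def)
  finally have "G\<^sup>2 / (4 * real k ^ 2) \<le> (\<Sum>i\<in>P. \<Sum>a\<in>L i. list_drop P L S i a)" .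
  moreover have "(D\<^sup>2 / (2 * n))\<^sup>2 / (4 * real k ^ 2) \<le> G\<^sup>2 / (4 * real k ^ 2)"
    using G by (intro divide_right_mono power_mono) auto
  moreover have "(D\<^sup>2 / (2 * n))\<^sup>2 / (4 * real k ^ 2) = D ^ 4 / (16 * real n ^ 2 * real k ^ 2)"
    by (simp add: power_divide power_mult_distrib)
  ultimately show ?thesis by linarith
qed

text \<open>Averaging: there are \<open>D\<close> pairs, each with a drop of at most
  \<open>D\<close>. With fewer than \<open>N\<close> drops of size \<open>d\<close>, the total would
  be below \<open>D * (d + N)\<close>.\<close>

lemma many_large_list_drops:
  fixes P :: "'a set" and A :: "'b set" and L :: "'a \<Rightarrow> 'b set"
  assumes P: "finite P" "card P \<le> k" and A: "finite A" "card A = n" "k \<ge> 1" "n \<ge> 1"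
    and L: "\<And>i. i \<in> P \<Longrightarrow> L i \<subseteq> A" and S: "rev_free_on P S"
  defines "D \<equiv> \<Sum>i\<in>P. real (card (L i))"
  assumes D: "D \<ge> 2 * n" "D\<^sup>2 \<ge> 4 * n * real k ^ 2"
    and d: "0 \<le> d" "d + N \<le> D ^ 3 / (16 * n ^ 2 * k ^ 2)"
  shows "N \<le> card {(i, a). i \<in> P \<and> a \<in> L i \<and> list_drop P L S i a \<ge> d}"
proof (rule ccontr)
  define Z where "Z = {(i, a). i \<in> P \<and> a \<in> L i \<and> list_drop P L S i a \<ge> d}"
  assume "\<not> N \<le> card {(i, a). i \<in> P \<and> a \<in> L i \<and> list_drop P L S i a \<ge> d}"
  then have Z: "card Z < N" by (simp add: Z_def)
  have finL: "finite (L i)" if "i \<in> P" for i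
    using L[OF that] A finite_subset by blast
  have Xsub: "Z \<subseteq> Sigma P L" and fin: "finite (Sigma P L)"
    using P finL by (auto simp: Z_def)
  have drop_le: "list_drop P L S i a \<le> D" if "i \<in> P" for i a
  proof -
    have "list_drop P L S i a \<le> card (L i) + (\<Sum>j\<in>P - {i}. real (card (L j)))"
      unfolding list_drop_def using finL by (intro add_left_mono sum_mono) (auto intro!: card_mono)
    also have "\<dots> = D"
      using P that by (simp add: D_def sum.remove)
    finally show ?thesis .
  qed
  have "D > 0"
    using D(1) A by linarith
  have cS: "real (card (Sigma P L)) = D"
    using P finL by (simp add: D_def card_SigmaI)
  have "D ^ 4 / (16 * n ^ 2 * k ^ 2) \<le> (\<Sum>i\<in>P. \<Sum>a\<in>L i. list_drop P L S i a)"
    using sum_list_drop_ge[OF P A L S] D by (simp add: D_def)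
  also have "\<dots> = (\<Sum>(i, a)\<in>Sigma P L. list_drop P L S i a)"
    using P finL by (subst sum.Sigma) auto
  also have "\<dots> = (\<Sum>(i, a)\<in>Sigma P L - Z. list_drop P L S i a) + (\<Sum>(i, a)\<in>Z. list_drop P L S i a)"
    by (rule sum.subset_diff[OF Xsub fin])
  also have "\<dots> \<le> (\<Sum>(i, a)\<in>Sigma P L - Z. d) + (\<Sum>(i, a)\<in>Z. D)"
    using drop_le by (intro add_mono sum_mono) (auto simp: Z_def)
  also have "\<dots> \<le> D * d + card Z * D"
  proof -
    have "card (Sigma P L - Z) \<le> card (Sigma P L)"
      using fin by (intro card_mono) auto
    then show ?thesis
      using d(1) cS by (simp add: case_prod_unfold mult_right_mono)
  qed
  also have "\<dots> < D * (d + N)"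
    using Z \<open>D > 0\<close> by (simp add: algebra_simps)
  also have "\<dots> \<le> D * (D ^ 3 / (16 * n ^ 2 * k ^ 2))"
    using d(2) \<open>D > 0\<close> by (intro mult_left_mono) auto
  also have "\<dots> = D ^ 4 / (16 * n ^ 2 * k ^ 2)"
    by (simp add: power_eq_if)
  finally show False by simp
qed

section \<open>One round: fixing a letter or pruning the lists\<close>

lemma condition_on_letter:
  assumes P: "finite P" "i \<in> P" and finL: "\<forall>j\<in>P. finite (L j)"
    and S: "rev_free_on P S" "S \<subseteq> PiE P L"
  obtains S' where "rev_free_on (P - {i}) S'" "S' \<subseteq> PiE (P - {i}) (followers S i a)"
    "card S' = card {w \<in> S. w i = a}"
    "\<forall>j\<in>P. followers S i a j \<subseteq> L j"
    "(\<Sum>j\<in>P - {i}. real (card (followers S i a j))) =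
      (\<Sum>j\<in>P. real (card (L j))) - list_drop P L S i a"
proof
  let ?S' = "(\<lambda>w. restrict w (P - {i})) ` {w \<in> S. w i = a}"
  show "rev_free_on (P - {i}) ?S'"
    using S(1) by (auto simp: rev_free_on_def)
  show "?S' \<subseteq> PiE (P - {i}) (followers S i a)"
    unfolding image_subset_iff restrict_PiE_iff by (auto simp: followers_def)
  \<comment> \<open>Forgetting position \<open>i\<close> loses nothing, because all these words have
    \<open>a\<close> there.\<close>
  have "inj_on (\<lambda>w. restrict w (P - {i})) {w \<in> S. w i = a}"
  proof (rule inj_onI)
    fix w x assume wx: "w \<in> {w \<in> S. w i = a}" "x \<in> {w \<in> S. w i = a}"
      and eq: "restrict w (P - {i}) = restrict x (P - {i})"
    have "w j = x j" if "j \<in> P" for j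
      using fun_cong[OF eq, of j] wx that by (cases "j = i") auto
    then show "w = x"
      using wx S(2) by (intro PiE_ext[of w P L]) auto
  qed
  then show "card ?S' = card {w \<in> S. w i = a}"
    by (rule card_image)
  have sub: "followers S i a j \<subseteq> L j" if "j \<in> P" for j
    using that S(2) by (auto simp: followers_def PiE_iff)
  then show "\<forall>j\<in>P. followers S i a j \<subseteq> L j" ..
  have "real (card (followers S i a j)) = card (L j) - real (card (L j - followers S i a j))"
    if "j \<in> P" for j
    using sub[OF that] finL card_mono[of "L j" "followers S i a j"] that
    by (simp add: card_Diff_subset finite_subset of_nat_diff)
  then have "(\<Sum>j\<in>P - {i}. real (card (followers S i a j))) =
      (\<Sum>j\<in>P - {i}. real (card (L j))) - (\<Sum>j\<in>P - {i}. real (card (L j - followers S i a j)))"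
    by (simp add: sum_subtractf)
  also have "\<dots> = (\<Sum>j\<in>P. real (card (L j))) - list_drop P L S i a"
    using P by (simp add: list_drop_def sum.remove)
  finally show "(\<Sum>j\<in>P - {i}. real (card (followers S i a j))) =
      (\<Sum>j\<in>P. real (card (L j))) - list_drop P L S i a" .
qed

text \<open>Union bound: each deleted pair accounts for at most a fraction
  \<open>1 / (2 * card Z)\<close> of \<open>S\<close>, so together they account for at most
  half.\<close>

lemma prune_letters:
  assumes P: "finite P" and finL: "\<And>j. j \<in> P \<Longrightarrow> finite (L j)"
    and S: "S \<subseteq> PiE P L" and Z: "Z \<subseteq> Sigma P L" "card Z > 0"
    and rare: "\<And>i a. (i, a) \<in> Z \<Longrightarrow> 2 * card Z * card {w \<in> S. w i = a} \<le> card S"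
  defines "L' \<equiv> \<lambda>i. L i - {a. (i, a) \<in> Z}"
  shows "card S \<le> 2 * card (S \<inter> PiE P L')"
    and "(\<Sum>i\<in>P. card (L' i)) + card Z = (\<Sum>i\<in>P. card (L i))"
proof -
  have finS: "finite S"
    using S P finL finite_PiE finite_subset by metis
  have finX: "finite Z"
    using Z(2) card.infinite by fastforce
  have "S \<subseteq> (S \<inter> PiE P L') \<union> (\<Union>(i, a)\<in>Z. {w \<in> S. w i = a})"
    using S Z(1) by (fastforce simp: L'_def PiE_iff)
  then have "card S \<le> card ((S \<inter> PiE P L') \<union> (\<Union>(i, a)\<in>Z. {w \<in> S. w i = a}))"
    using finS finX by (intro card_mono) auto
  also have "\<dots> \<le> card (S \<inter> PiE P L') + card (\<Union>(i, a)\<in>Z. {w \<in> S. w i = a})"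
    by (rule card_Un_le)
  also have "\<dots> \<le> card (S \<inter> PiE P L') + (\<Sum>(i, a)\<in>Z. card {w \<in> S. w i = a})"
    using card_UN_le[OF finX, of "\<lambda>(i, a). {w \<in> S. w i = a}"] by (simp add: case_prod_unfold)
  finally have "card S \<le> card (S \<inter> PiE P L') + (\<Sum>(i, a)\<in>Z. card {w \<in> S. w i = a})" .
  from mult_le_mono2[OF this, of "2 * card Z"] have "2 * card Z * card S \<le>
      2 * card Z * card (S \<inter> PiE P L') + 2 * card Z * (\<Sum>(i, a)\<in>Z. card {w \<in> S. w i = a})"
    by (simp only: distrib_left)
  also have "2 * card Z * (\<Sum>(i, a)\<in>Z. card {w \<in> S. w i = a}) \<le> (\<Sum>(i, a)\<in>Z. card S)"
    unfolding sum_distrib_left using rare by (intro sum_mono) auto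
  also have "\<dots> = card Z * card S"
    by (simp add: case_prod_unfold)
  finally have "card Z * card S \<le> card Z * (2 * card (S \<inter> PiE P L'))"
    by simp
  then show "card S \<le> 2 * card (S \<inter> PiE P L')"
    using Z(2) by simp
  have "card (Sigma P L) = card (Sigma P L - Z) + card Z"
    using Z(1) finX P finL card_mono[of "Sigma P L" Z] by (simp add: card_Diff_subset)
  moreover have "Sigma P L - Z = Sigma P L'"
    by (auto simp: L'_def)
  ultimately show "(\<Sum>i\<in>P. card (L' i)) + card Z = (\<Sum>i\<in>P. card (L i))"
    using P finL by (simp add: card_SigmaI L'_def)
qed

text \<open>The dichotomy of a round, decided by whether one of \<open>N\<close> pairs with large
  drop is popular. The factor of order \<open>N\<close> is paid only when a position is used
  up.\<close>

lemma rev_free_on_shrink: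
  fixes P :: "'a set" and L :: "'a \<Rightarrow> 'b set"
  assumes P: "finite P" and finL: "\<forall>j\<in>P. finite (L j)"
    and S: "rev_free_on P S" "S \<subseteq> PiE P L"
    and N: "0 < N" "N \<le> card {(i, a). i \<in> P \<and> a \<in> L i \<and> list_drop P L S i a \<ge> d}"
  defines "D \<equiv> \<Sum>i\<in>P. real (card (L i))"
  obtains (fix_letter) i L' S' where "i \<in> P" "rev_free_on (P - {i}) S'" "S' \<subseteq> PiE (P - {i}) L'"
      "\<And>j. j \<in> P \<Longrightarrow> L' j \<subseteq> L j" "(\<Sum>j\<in>P - {i}. real (card (L' j))) \<le> D - d"
      "card S \<le> 2 * N * card S'"
    | (prune) L' S' where "rev_free_on P S'" "S' \<subseteq> PiE P L'" "\<And>j. j \<in> P \<Longrightarrow> L' j \<subseteq> L j"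
      "(\<Sum>j\<in>P. real (card (L' j))) \<le> D - N" "card S \<le> 2 * card S'"
proof -
  obtain Z where Z: "Z \<subseteq> {(i, a). i \<in> P \<and> a \<in> L i \<and> list_drop P L S i a \<ge> d}" "card Z = N"
    by (rule obtain_subset_with_card_n[OF N(2)]) blast
  show thesis
  proof (cases "\<exists>(i, a)\<in>Z. card S \<le> 2 * N * card {w \<in> S. w i = a}")
    case True
    then obtain i a where ia: "(i, a) \<in> Z" and le: "card S \<le> 2 * N * card {w \<in> S. w i = a}"
      by auto
    with Z(1) have i: "i \<in> P" "list_drop P L S i a \<ge> d"
      by auto
    obtain S' where S': "rev_free_on (P - {i}) S'" "S' \<subseteq> PiE (P - {i}) (followers S i a)"
      "card S' = card {w \<in> S. w i = a}" "\<forall>j\<in>P. followers S i a j \<subseteq> L j"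
      "(\<Sum>j\<in>P - {i}. real (card (followers S i a j))) =
        (\<Sum>j\<in>P. real (card (L j))) - list_drop P L S i a"
      using condition_on_letter[OF P i(1) finL S, where a = a] by blast
    show thesis
      using i le S' by (intro fix_letter[of i S' "followers S i a"]) (auto simp: D_def)
  next
    case False
    have XS: "Z \<subseteq> Sigma P L"
      using Z(1) by auto
    define L' where "L' = (\<lambda>i. L i - {a. (i, a) \<in> Z})"
    have le: "card S \<le> 2 * card (S \<inter> PiE P L')"
      and sum: "(\<Sum>i\<in>P. card (L' i)) + card Z = (\<Sum>i\<in>P. card (L i))"
      unfolding L'_def using False Z(2) N(1)
      by (intro prune_letters[OF P bspec[OF finL] S(2) XS]; force)+
    have "(\<Sum>i\<in>P. real (card (L' i))) + N = D"
      using arg_cong[OF sum, of real] Z(2) by (simp add: D_def)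
    then show thesis
      using le rev_free_on_subset[OF S(1), of P "S \<inter> PiE P L'"]
      by (intro prune[of "S \<inter> PiE P L'" L']) (auto simp: L'_def)
  qed
qed

section \<open>Numerical estimates for the thresholds \<open>10 * k * n / sqrt s\<close>\<close>

lemma inverse_sqrt_diff_le:
  fixes s :: nat
  assumes "s \<ge> 1"
  shows "1 / sqrt s - 1 / sqrt (Suc s) \<le> 1 / (2 * sqrt s ^ 3)"
proof -
  define x y where "x = sqrt s" and "y = sqrt (Suc s)"
  have x: "x \<ge> 1" and xy: "x \<le> y" and sq: "y * y = x * x + 1"
    using assms by (auto simp: x_def y_def)
  \<comment> \<open>As \<open>(y - x) * (y + x) = 1\<close>, the difference of the roots is at most
    \<open>1 / (2 * x)\<close>.\<close>
  have "(y - x) * (2 * x) \<le> (y - x) * (y + x)"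
    using xy by (intro mult_left_mono) auto
  also have "\<dots> = 1"
    using sq by (simp add: algebra_simps)
  finally have "(y - x) * (2 * x) \<le> 1" .
  moreover have "x * x \<le> y * x"
    using x xy by (intro mult_right_mono) auto
  ultimately have "(y - x) * (2 * x) * (x * x) \<le> 1 * (y * x)"
    using x by (rule_tac mult_mono) auto
  then have "1 / x - 1 / y \<le> 1 / (2 * x ^ 3)"
    using x xy by (simp add: field_simps power3_eq_cube)
  then show ?thesis
    by (simp add: x_def y_def)
qed

text \<open>While \<open>D\<close> is above the next threshold, \<open>many_large_list_drops\<close>
  applies with \<open>d + N\<close> up to \<open>15 * k * n / sqrt s ^ 3\<close>. The constant 10
  suffices as \<open>10 ^ 3 / 16 = 125 / 2\<close> exceeds \<open>15 * (27 / 8)\<close>, where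
  \<open>27 / 8\<close> is the cube in \<open>sqrt (Suc s) \<le> 3 / 2 * sqrt s\<close>.\<close>

lemma list_sum_lower_bounds:
  fixes s k n :: nat and D :: real
  assumes s: "1 \<le> s" "s < k" "k \<le> n" and D: "10 * k * n / sqrt (Suc s) \<le> D"
  shows "2 * n \<le> D" "4 * n * real k ^ 2 \<le> D\<^sup>2"
    "15 * k * n / sqrt s ^ 3 \<le> D ^ 3 / (16 * n ^ 2 * k ^ 2)"
proof -
  define t where "t = sqrt (Suc s)"
  have t2: "t\<^sup>2 = Suc s"
    by (simp add: t_def)
  have t1: "t \<ge> 1"
    by (simp add: t_def)
  have tk: "t\<^sup>2 \<le> k"
    using s unfolding t2 by linarith
  have "t \<le> t\<^sup>2"
    using t1 by (simp add: power2_eq_square)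
  with tk have "t \<le> k" by linarith
  have kn: "real k \<ge> 1" "real n \<ge> 1" "real k \<le> n"
    using s by auto
  have D0: "10 * real k * real n / t \<le> D"
    using D by (simp add: t_def)
  have "2 * real n * t \<le> 10 * real n * real k"
    using \<open>t \<le> k\<close> t1 kn by (intro mult_mono) auto
  then have "2 * real n \<le> 10 * real k * real n / t"
    using t1 by (simp add: field_simps)
  with D0 show "2 * n \<le> D" by linarith
  have "t\<^sup>2 * (4 * n * real k ^ 2) \<le> n * (100 * n * real k ^ 2)"
    using tk kn by (intro mult_mono) auto
  then have "4 * n * real k ^ 2 \<le> (10 * real k * real n / t)\<^sup>2"
    using t1 by (simp add: power_divide power_mult_distrib field_simps power2_eq_square[of "real n"])
  also have "\<dots> \<le> D\<^sup>2"
    using D0 t1 by (intro power_mono) auto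
  finally show "4 * n * real k ^ 2 \<le> D\<^sup>2" .
  have "t \<le> 3 / 2 * sqrt s"
  proof (rule power2_le_imp_le)
    show "t\<^sup>2 \<le> (3 / 2 * sqrt s)\<^sup>2"
      using s by (simp add: t2 power_mult_distrib power_divide)
  qed simp
  then have "t ^ 3 \<le> (3 / 2 * sqrt s) ^ 3"
    using t1 by (intro power_mono) auto
  then have t3: "t ^ 3 \<le> 27 / 8 * sqrt s ^ 3"
    by (simp add: power_mult_distrib power3_eq_cube)
  have "15 * k * n / sqrt s ^ 3 = 15 * (27 / 8) * k * n / (27 / 8 * sqrt s ^ 3)"
    by simp
  also have "\<dots> \<le> 15 * (27 / 8) * k * n / t ^ 3"
    using t3 t1 s by (intro divide_left_mono) (auto intro!: mult_pos_pos)
  also have "\<dots> \<le> (125 / 2) * k * n / t ^ 3"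
    using t1 by (intro divide_right_mono mult_right_mono) auto
  also have "\<dots> = (10 * real k * real n / t) ^ 3 / (16 * n ^ 2 * k ^ 2)"
    using kn t1 by (simp add: power_divide power_mult_distrib field_simps power3_eq_cube power2_eq_square)
  also have "\<dots> \<le> D ^ 3 / (16 * n ^ 2 * k ^ 2)"
    using D0 t1 by (intro divide_right_mono power_mono) auto
  finally show "15 * k * n / sqrt s ^ 3 \<le> D ^ 3 / (16 * n ^ 2 * k ^ 2)" .
qed

text \<open>For \<open>d = 5 * k * n / sqrt s ^ 3\<close>, the first bound makes rounding up at most
  a doubling. The second covers the cost \<open>2 * N \<le> 4 * d\<close> of fixing a letter by one
  factor \<open>n / sqrt k\<close> and the factor of the round.\<close>

lemma drop_size_bounds:
  fixes s k n :: nat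
  assumes "1 \<le> s" "s \<le> k" "k \<le> n"
  shows "1 \<le> 5 * k * n / sqrt s ^ 3"
    "20 * k * n / sqrt s ^ 3 \<le> 40 * (real k / s)\<^sup>2 * (n / sqrt k)"
proof -
  define x y where "x = sqrt s" and "y = sqrt k"
  have x: "x \<ge> 1" and xy: "x \<le> y" and sq: "real k = y\<^sup>2" "real s = x\<^sup>2"
    using assms by (auto simp: x_def y_def)
  have n: "y\<^sup>2 \<le> real n"
    using assms sq by (metis of_nat_le_iff)
  have "x ^ 3 * 1 \<le> y ^ 3 * (5 * y)"
    using x xy by (intro mult_mono power_mono) auto
  also have "\<dots> = 5 * y\<^sup>2 * y\<^sup>2"
    by (simp add: power2_eq_square power3_eq_cube)
  also have "\<dots> \<le> 5 * y\<^sup>2 * n"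
    using n by (intro mult_left_mono) auto
  finally show "1 \<le> 5 * k * n / sqrt s ^ 3"
    using x unfolding of_nat_mult sq(1) x_def[symmetric] by (simp add: field_simps)
  have "20 * y\<^sup>2 * n * x \<le> 40 * y\<^sup>2 * n * y"
    using x xy by (intro mult_mono) auto
  then have "20 * y\<^sup>2 * n / x ^ 3 \<le> 40 * (y\<^sup>2 / x\<^sup>2)\<^sup>2 * (n / y)"
    using x xy by (simp add: field_simps power2_eq_square power3_eq_cube)
  then show "20 * k * n / sqrt s ^ 3 \<le> 40 * (real k / s)\<^sup>2 * (n / sqrt k)"
    unfolding x_def[symmetric] y_def[symmetric] unfolding of_nat_mult sq by simp
qed

text \<open>Induction from \<open>s = k\<close> downwards, one round per value of \<open>s\<close>.
  Each used position is paid by a factor \<open>n / sqrt k\<close>, each round by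
  \<open>40 * (k / s) ^ 2\<close>. At \<open>s = k\<close> the product of the list sizes is bounded
  with scale \<open>n / sqrt k\<close>, which yields \<open>exp (10 * k)\<close>.\<close>

lemma rev_free_card_le:
  fixes P :: "'a set" and A :: "'b set" and L :: "'a \<Rightarrow> 'b set" and n k s :: nat
  assumes A: "finite A" "card A = n" and kn: "1 \<le> k" "k \<le> n" and s: "s \<le> k" "1 \<le> s"
    and P: "finite P" "card P \<le> k" and L: "\<And>i. i \<in> P \<Longrightarrow> L i \<subseteq> A"
    and S: "rev_free_on P S" "S \<subseteq> PiE P L"
    and D: "(\<Sum>i\<in>P. real (card (L i))) \<le> 10 * k * n / sqrt s"
  shows "card S \<le> (n / sqrt k) ^ card P * exp (10 * k) * (\<Prod>t\<in>{s..<k}. 40 * (real k / t)\<^sup>2)"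
  using s P L S D
proof (induction s arbitrary: P L S rule: inc_induct)
  case base
  note P = base(2,3) and L = base(4) and S = base(5,6) and D = base(7)
  have finL: "finite (L i)" if "i \<in> P" for i
    using L[OF that] A finite_subset by blast
  have "card S \<le> card (PiE P L)"
    using S P finL by (intro card_mono finite_PiE) auto
  also have "real \<dots> = (\<Prod>i\<in>P. real (card (L i)))"
    using P by (simp add: card_PiE)
  also have "\<dots> \<le> (n / sqrt k) ^ card P * exp ((\<Sum>i\<in>P. real (card (L i))) / (n / sqrt k))"
    using kn by (intro prod_le_power_exp_sum) auto
  also have "(\<Sum>i\<in>P. real (card (L i))) / (n / sqrt k) \<le> (10 * k * n / sqrt k) / (n / sqrt k)"
    using D by (intro divide_right_mono) auto
  also have "\<dots> = 10 * k"
    using kn by simp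
  finally show ?case
    by (simp add: mult_left_mono)
next
  case (step s)
  note s = step.hyps(2) step.prems(1)
  note P = step.prems(2,3) and L = step.prems(4) and S = step.prems(5,6)
  have finL: "finite (L i)" if "i \<in> P" for i
    using L[OF that] A finite_subset by blast
  define lam where "lam t = 40 * (real k / real t)\<^sup>2" for t :: nat
  define \<theta> where "\<theta> = n / sqrt k"
  define B where "B = 10 * k * n / sqrt (Suc s)"
  define R where "R = exp (10 * k) * (\<Prod>t\<in>{Suc s..<k}. lam t)"
  have R: "R \<ge> 0"
    unfolding R_def lam_def by (intro mult_nonneg_nonneg prod_nonneg) auto
  have \<theta>: "\<theta> \<ge> 0"
    by (simp add: \<theta>_def)
  have IH: "card T \<le> \<theta> ^ card Q * R"
    if "finite Q" "card Q \<le> k" "\<And>i. i \<in> Q \<Longrightarrow> M i \<subseteq> A" "rev_free_on Q T" "T \<subseteq> PiE Q M"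
      "(\<Sum>i\<in>Q. real (card (M i))) \<le> B" for Q M and T :: "('a \<Rightarrow> 'b) set"
    using step.IH[OF _ that(1,2) _ that(4,5)] that(3,6)
    by (simp add: \<theta>_def R_def B_def lam_def mult.assoc)
  have goal: ?case if "card S \<le> lam s * \<theta> ^ card P * R"
    using that s by (simp add: prod.atLeast_Suc_lessThan \<theta>_def R_def lam_def algebra_simps)
  have "1 \<le> real k / s"
    using s by simp
  then have "40 * 1\<^sup>2 \<le> lam s"
    unfolding lam_def by (intro mult_left_mono power_mono) auto
  then have lam: "2 \<le> lam s" by simp
  define D where "D = (\<Sum>i\<in>P. real (card (L i)))"
  show ?case
  proof (cases "D \<le> B")
    case True
    \<comment> \<open>The lists are already below the next threshold, so the round is skipped and
      its factor is given away.\<close>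
    have "card S \<le> 1 * (\<theta> ^ card P * R)"
      using IH[OF P L S] True by (simp add: D_def)
    also have "\<dots> \<le> lam s * (\<theta> ^ card P * R)"
      using lam R \<theta> by (intro mult_right_mono) auto
    finally show ?thesis
      by (intro goal) (simp add: mult.assoc)
  next
    case False
    \<comment> \<open>By \<open>inverse_sqrt_diff_le\<close>, this \<open>d\<close> is at least the
      gap between two successive thresholds.\<close>
    define d where "d = 5 * k * n / sqrt s ^ 3"
    define N where "N = nat \<lceil>d\<rceil>"
    have d1: "d \<ge> 1"
      using drop_size_bounds(1)[of s k n] s kn by (simp add: d_def)
    then have N: "d \<le> N" "N \<le> 2 * d" "0 < N"
      unfolding N_def by linarith+
    have "D \<ge> B"
      using False by simp
    then have D_lower: "2 * n \<le> D" "4 * n * real k ^ 2 \<le> D\<^sup>2" "15 * k * n / sqrt s ^ 3 \<le> D ^ 3 / (16 * n ^ 2 * k ^ 2)"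
      using list_sum_lower_bounds[of s k n D] s kn by (auto simp: B_def)
    have "d + N \<le> 15 * k * n / sqrt s ^ 3"
      using N(2) by (simp add: d_def)
    with D_lower(3) have dN: "d + N \<le> D ^ 3 / (16 * n ^ 2 * k ^ 2)"
      by linarith
    have "n \<ge> 1"
      using kn by linarith
    have many: "N \<le> card {(i, a). i \<in> P \<and> a \<in> L i \<and> list_drop P L S i a \<ge> d}"
      using many_large_list_drops[OF P A kn(1) \<open>n \<ge> 1\<close> L S(1), where d = d and N = N] D_lower(1,2) dN d1
      by (simp add: D_def)
    have "10 * k * n * (1 / sqrt s - 1 / sqrt (Suc s)) \<le> 10 * k * n * (1 / (2 * sqrt s ^ 3))"
      using s by (intro mult_left_mono inverse_sqrt_diff_le) auto
    then have "10 * k * n / sqrt s - d \<le> B"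
      by (simp add: B_def d_def right_diff_distrib)
    then have Dd: "D - d \<le> B"
      using step.prems(7) by (simp add: D_def)
    have "\<forall>i\<in>P. finite (L i)"
      using finL by blast
    from P(1) this S N(3) many show ?thesis
    proof (cases rule: rev_free_on_shrink)
      case (fix_letter i L' S')
      have cP: "card P = Suc (card (P - {i}))"
        using P(1) fix_letter(1) by (rule card.remove)
      have L': "L' j \<subseteq> A" if "j \<in> P" for j
        using fix_letter(4)[OF that] L[OF that] by blast
      have S': "card S' \<le> \<theta> ^ card (P - {i}) * R"
        using fix_letter(5) Dd P cP L' by (intro IH[OF _ _ _ fix_letter(2,3)]) (auto simp: D_def)
      have "2 * N \<le> lam s * \<theta>"
        using N(2) drop_size_bounds(2)[of s k n] s kn by (simp add: lam_def \<theta>_def d_def)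
      have "real (card S) \<le> 2 * N * real (card S')"
        using fix_letter(6) by (metis of_nat_le_iff of_nat_mult of_nat_numeral)
      also have "\<dots> \<le> (lam s * \<theta>) * (\<theta> ^ card (P - {i}) * R)"
        using S' \<open>2 * N \<le> lam s * \<theta>\<close> lam \<theta> by (intro mult_mono) auto
      finally show ?thesis
        by (intro goal) (simp add: cP mult.assoc)
    next
      case (prune L' S')
      have L': "L' j \<subseteq> A" if "j \<in> P" for j
        using prune(3)[OF that] L[OF that] by blast
      have S': "card S' \<le> \<theta> ^ card P * R"
        using prune(4) Dd N(1) by (intro IH[OF P L' prune(1,2)]) (auto simp: D_def)
      have "real (card S) \<le> 2 * real (card S')"
        using prune(5) by linarith
      also have "\<dots> \<le> lam s * (\<theta> ^ card P * R)"
        using S' lam by (intro mult_mono) auto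
      finally show ?thesis
        by (intro goal) (simp add: mult.assoc)
    qed
  qed
qed

text \<open>The rounds start at \<open>s = 1\<close> with full lists, whose total size
  \<open>k * n\<close> is below the threshold. The factors \<open>(k / t) ^ 2\<close> multiply to at
  most \<open>exp (2 * k)\<close>, so 12 arises as \<open>10 + 2\<close>.\<close>

lemma F_bar_le:
  assumes kn: "1 \<le> k" "k \<le> n"
  shows "F_bar n k \<le> (40 * exp 12 * n / sqrt k) ^ k"
proof -
  obtain W where W: "W \<subseteq> words n k" "reverse_free W" "card W = F_bar n k"
    using Max_card_reverse_free(1)[OF finite_words, of n k] unfolding F_bar_def by blast
  define S where "S = (\<lambda>w. \<lambda>i\<in>{..<k}. w ! i) ` W"
  have len: "length w = k" if "w \<in> W" for w
    using W(1) that by (auto simp: words_def)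
  have "inj_on (\<lambda>w. \<lambda>i\<in>{..<k}. w ! i) W"
  proof (rule inj_onI)
    fix w x assume wx: "w \<in> W" "x \<in> W" and eq: "(\<lambda>i\<in>{..<k}. w ! i) = (\<lambda>i\<in>{..<k}. x ! i)"
    have "w ! i = x ! i" if "i < k" for i
      using fun_cong[OF eq, of i] that by simp
    then show "w = x"
      using len wx by (intro nth_equalityI) auto
  qed
  then have cS: "card S = F_bar n k"
    using W(3) by (simp add: S_def card_image)
  have "S \<subseteq> PiE {..<k} (\<lambda>_. {1..n})"
    using W(1) len by (fastforce simp: S_def words_def set_conv_nth)
  moreover have "rev_free_on {..<k} S"
    unfolding rev_free_on_def
  proof (intro ballI impI notI)
    fix f g i j assume "f \<in> S" "g \<in> S" and ij: "i \<in> {..<k}" "j \<in> {..<k}"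
      and "f i \<noteq> f j" "f i = g j \<and> f j = g i"
    then obtain w x where wx: "w \<in> W" "x \<in> W" "w ! i \<noteq> w ! j" "w ! i = x ! j" "w ! j = x ! i"
      by (auto simp: S_def)
    then have "w \<noteq> x" by auto
    moreover have "have_reverse w x"
      unfolding have_reverse_def using wx ij len by (intro conjI exI[of _ i] exI[of _ j]) auto
    ultimately show False
      using W(2) wx by (auto simp: reverse_free_def)
  qed
  ultimately have "card S \<le> (n / sqrt k) ^ card {..<k} * exp (10 * k) * (\<Prod>t\<in>{1..<k}. 40 * (real k / t)\<^sup>2)"
    using kn by (intro rev_free_card_le[where A = "{1..n}" and L = "\<lambda>_. {1..n}"]) auto
  also have "(\<Prod>t\<in>{1..<k}. 40 * (real k / t)\<^sup>2) \<le> 40 ^ k * exp k ^ 2"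
  proof -
    have "(\<Prod>t\<in>{1..<k}. real k / t) = real k ^ (k - 1) / fact (k - 1)"
      using kn by (simp add: prod_dividef fact_prod atLeastLessThanSuc_atLeastAtMost[symmetric])
    also have "\<dots> \<le> exp k"
    proof -
      \<comment> \<open>The quotient is a single term of the exponential series at
        \<open>k\<close>.\<close>
      have "(\<Sum>i\<in>{k - 1}. real k ^ i /\<^sub>R fact i) \<le> (\<Sum>i. real k ^ i /\<^sub>R fact i)"
        by (intro sum_le_suminf summable_exp_generic) auto
      then show ?thesis
        by (simp add: exp_def divide_inverse mult.commute)
    qed
    finally have "(\<Prod>t\<in>{1..<k}. real k / t) \<le> exp k" .
    then have "(\<Prod>t\<in>{1..<k}. real k / t)\<^sup>2 \<le> exp k ^ 2"
      by (intro power_mono prod_nonneg) auto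
    moreover have "(40::real) ^ (k - 1) \<le> 40 ^ k"
      by (intro power_increasing) auto
    ultimately have "40 ^ (k - 1) * (\<Prod>t\<in>{1..<k}. real k / t)\<^sup>2 \<le> 40 ^ k * exp k ^ 2"
      by (intro mult_mono) auto
    then show ?thesis
      by (simp add: prod.distrib prod_power_distrib)
  qed
  also have "(n / sqrt k) ^ card {..<k} * exp (10 * k) * (40 ^ k * exp k ^ 2) = (40 * exp 12 * n / sqrt k) ^ k"
  proof -
    have "exp (real (10 * k)) * exp (real k) ^ 2 = exp 12 ^ k"
      by (simp flip: exp_of_nat_mult exp_add)
    then show ?thesis
      by (simp add: power_mult_distrib power_divide algebra_simps)
  qed
  finally show ?thesis
    by (simp add: cS mult_left_mono)
qed

section \<open>The theorem\<close>

lemma card_words: "card (words n k) = n ^ k"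
  using card_lists_length_eq[of "{1..n}" k] by (simp add: words_def conj_commute)

lemma F_le_F_bar: "F n k \<le> F_bar n k"
proof -
  have sub: "rep_free_words n k \<subseteq> words n k"
    by (auto simp: rep_free_words_def)
  obtain S where S: "S \<subseteq> rep_free_words n k" "reverse_free S" "card S = F n k"
    using Max_card_reverse_free(1)[OF finite_subset[OF sub finite_words]] unfolding F_def by blast
  have "card S \<le> F_bar n k"
    unfolding F_bar_def using S sub by (intro Max_card_reverse_free(2)[OF finite_words]) auto
  with S show ?thesis by simp
qed

text \<open>At \<open>k = 1\<close> both bounds of the theorem equal \<open>n\<close>, because
  \<open>1 powr x = 1\<close>, so exact values are required.\<close>

lemma F_1: "F n 1 = n" and F_bar_1: "F_bar n 1 = n"
proof -
  have words: "rep_free_words n 1 = words n 1"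
    by (auto simp: rep_free_words_def words_def length_Suc_conv)
  have "reverse_free (words n 1)"
    by (auto simp: reverse_free_def have_reverse_def words_def)
  then have "n \<le> F n 1"
    using Max_card_reverse_free(2)[OF finite_words, of "words n 1" n 1]
    unfolding F_def words by (simp add: card_words)
  moreover obtain S where "S \<subseteq> words n 1" "card S = F_bar n 1"
    using Max_card_reverse_free(1)[OF finite_words, of n 1] unfolding F_bar_def by blast
  then have "F_bar n 1 \<le> n"
    using card_mono[OF finite_words, of S n 1] by (simp add: card_words)
  ultimately show "F n 1 = n" "F_bar n 1 = n"
    using F_le_F_bar[of n 1] by linarith+
qed

text \<open>Since \<open>k powr (k / ln k) = exp k\<close>, the multiple \<open>ln c\<close> in the
  exponent amounts to a factor \<open>c\<close> per position. The case \<open>k \<ge> 2\<close>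
  keeps \<open>ln k\<close> away from 0.\<close>

lemma powr_half_eq:
  fixes k n :: nat and c :: real
  assumes "k \<ge> 2" "c > 0"
  shows "real n ^ k * real k powr (- real k / 2 + ln c * (real k / ln (real k))) = (c * n / sqrt k) ^ k"
proof -
  have "real k powr (ln c * (real k / ln (real k))) = exp (real k * ln c)"
    using assms by (simp add: powr_def)
  also have "\<dots> = c ^ k"
    using assms by (simp add: exp_of_nat_mult)
  finally have pow: "real k powr (ln c * (real k / ln (real k))) = c ^ k" .
  have "real k powr (- real k / 2 + ln c * (real k / ln (real k))) =
      real k powr (- real k / 2) * c ^ k"
    unfolding powr_add pow ..
  also have "real k powr (- real k / 2) = 1 / sqrt k ^ k"
    using assms by (simp add: powr_half_sqrt[symmetric] powr_minus_divide powr_powr flip: powr_realpow)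
  finally show ?thesis
    by (simp add: power_divide power_mult_distrib mult.commute)
qed

theorem theorem1:
  shows "\<exists>C::real. \<forall>n k :: nat. 1 \<le> k \<longrightarrow> k \<le> n \<longrightarrow>
    real n ^ k * real k powr (- real k / 2 - C * (real k / ln (real k))) \<le> real (F n k) \<and>
    F n k \<le> F_bar n k \<and>
    real (F_bar n k) \<le> real n ^ k * real k powr (- real k / 2 + C * (real k / ln (real k)))"
proof (intro exI allI impI)
  \<comment> \<open>The larger of the two constants serves both bounds; the lower one uses
    \<open>ln (1 / c) = - ln c\<close>.\<close>
  define c :: real where "c = 40 * exp 12"
  have c: "c > 0" "32 * exp 4 \<le> c"
    unfolding c_def by (auto intro!: mult_mono)
  fix n k :: nat assume kn: "1 \<le> k" "k \<le> n"
  show "real n ^ k * real k powr (- real k / 2 - ln c * (real k / ln (real k))) \<le> real (F n k) \<and>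
    F n k \<le> F_bar n k \<and>
    real (F_bar n k) \<le> real n ^ k * real k powr (- real k / 2 + ln c * (real k / ln (real k)))"
  proof (cases "k = 1")
    case True
    then show ?thesis
      by (simp add: F_1[unfolded One_nat_def] F_bar_1[unfolded One_nat_def])
  next
    case False
    with kn have k: "k \<ge> 2" by simp
    have "real n ^ k * real k powr (- real k / 2 - ln c * (real k / ln (real k))) = (1 / c * n / sqrt k) ^ k"
      using powr_half_eq[OF k, of "1 / c" n] c by (simp add: ln_div)
    also have "1 / c * n / sqrt k \<le> 1 / (32 * exp 4) * n / sqrt k"
      using c by (intro divide_right_mono mult_right_mono divide_left_mono) auto
    then have "(1 / c * n / sqrt k) ^ k \<le> (1 / (32 * exp 4) * n / sqrt k) ^ k"
      using c by (intro power_mono) auto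
    also have "\<dots> \<le> F n k"
      using F_ge[OF kn] by simp
    finally have "real n ^ k * real k powr (- real k / 2 - ln c * (real k / ln (real k))) \<le> F n k" .
    moreover have "F_bar n k \<le> real n ^ k * real k powr (- real k / 2 + ln c * (real k / ln (real k)))"
      using F_bar_le[OF kn] powr_half_eq[OF k c(1), of n] by (simp add: c_def)
    ultimately show ?thesis
      using F_le_F_bar by blast
  qed
qed

end
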